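(* Let $\alpha$ and $\beta$ be two multiplicatively independent Perron numbers. Let ${\sf x}$ be a sequence on a finite alphabet. Then ${\sf x}$ is both $\alpha$-substitutive primitive and $\beta$-substitutive primitive if and only if ${\sf x}$ is periodic.
   Context: Multiplicatively independent means $\alpha^k\neq\beta^l$ for all integers $k,l>0$. A Perron number is a real algebraic integer strictly dominating in modulus all its other algebraic conjugates. ${\sf x}$ is periodic if ${\sf x}=vvv\cdots$ for a non-empty word $v$. A substitution is a morphism $\sigma:A\to A^*$ on a finite alphabet with $|\sigma^n(a)|\to\infty$ for all $a\in A$; it is primitive if some power of its matrix (entry $(i,j)$ = number of occurrences of $i$ in $\sigma(j)$) has all entries positive; its dominant eigenvalue is the spectral radius of that matrix. A sequence is $\theta$-substitutive primitive if it equals $\phi({\sf y})$ where ${\sf y}$ is a fixed point of a primitive substitution with dominant eigenvalue $\theta$ and $\phi$ is a letter to letter morphism (sending letters to letters).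
   Formalization: The formal theorem adds α > 1 and β > 1: under the stated definition 1 and 2 are multiplicatively independent Perron numbers, yet no sequence is 1-substitutive primitive (growing primitive substitutions have dominant eigenvalue > 1), so the "if" part fails for Perron numbers ≤ 1. *)

theory Defs
  imports
    "HOL-Computational_Algebra.Polynomial_Factorial"
    "HOL-Library.Stream"
    "Jordan_Normal_Form.Spectral_Radius"
begin

definition is_minimal_poly :: "rat poly \<Rightarrow> complex \<Rightarrow> bool" where
  "is_minimal_poly p z \<longleftrightarrow>
     lead_coeff p = 1 \<and> irreducible p \<and> poly (map_poly of_rat p) z = 0"

definition algebraic_conjugate :: "complex \<Rightarrow> complex \<Rightarrow> bool" where
  "algebraic_conjugate w z \<longleftrightarrow> (\<exists>p. is_minimal_poly p w \<and> is_minimal_poly p z)"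

text \<open>
  No sign or size condition is built in; every rational integer, including \<open>0\<close>, \<open>1\<close> and the
  negative ones, satisfies this predicate because it has no other conjugate.
\<close>
definition perron_number :: "real \<Rightarrow> bool" where
  "perron_number \<alpha> \<longleftrightarrow>
     algebraic_int \<alpha> \<and>
     (\<forall>z. algebraic_conjugate (complex_of_real \<alpha>) z \<and> z \<noteq> complex_of_real \<alpha>
          \<longrightarrow> cmod z < \<bar>\<alpha>\<bar>)"

definition mult_independent :: "real \<Rightarrow> real \<Rightarrow> bool" where
  "mult_independent \<alpha> \<beta> \<longleftrightarrow> (\<forall>k l :: nat. k > 0 \<and> l > 0 \<longrightarrow> \<alpha> ^ k \<noteq> \<beta> ^ l)"

definition periodic :: "'a stream \<Rightarrow> bool" where
  "periodic x \<longleftrightarrow> (\<exists>v. v \<noteq> [] \<and> x = cycle v)"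

text \<open>
  A morphism is given by its values on letters. \<open>morph_word\<close> is its extension to finite words and
  \<open>morph_seq\<close> its extension to infinite words. The latter is meaningful only if \<open>\<sigma>\<close> is non-erasing
  (because of \<^const>\<open>flat\<close>), which holds for every substitution by the growth condition.
\<close>
definition morph_word :: "('b \<Rightarrow> 'c list) \<Rightarrow> 'b list \<Rightarrow> 'c list" where
  "morph_word \<sigma> w = concat (map \<sigma> w)"

definition morph_seq :: "('b \<Rightarrow> 'c list) \<Rightarrow> 'b stream \<Rightarrow> 'c stream" where
  "morph_seq \<sigma> y = flat (smap \<sigma> y)"

text \<open>
  The alphabet of a substitution is numbered \<open>0, \<dots>, d - 1\<close>, which costs no generality and fixes
  the indexing of its matrix. Values of \<open>\<sigma>\<close> outside the alphabet are irrelevant.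
\<close>
definition substitution :: "nat \<Rightarrow> (nat \<Rightarrow> nat list) \<Rightarrow> bool" where
  "substitution d \<sigma> \<longleftrightarrow>
     (\<forall>a<d. set (\<sigma> a) \<subseteq> {..<d}) \<and>
     (\<forall>a<d. filterlim (\<lambda>n. length ((morph_word \<sigma> ^^ n) [a])) at_top sequentially)"

definition subst_mat :: "nat \<Rightarrow> (nat \<Rightarrow> nat list) \<Rightarrow> nat mat" where
  "subst_mat d \<sigma> = mat d d (\<lambda>(i, j). count_list (\<sigma> j) i)"

definition primitive_subst :: "nat \<Rightarrow> (nat \<Rightarrow> nat list) \<Rightarrow> bool" where
  "primitive_subst d \<sigma> \<longleftrightarrow>
     substitution d \<sigma> \<and>
     (\<exists>k>0. \<forall>i<d. \<forall>j<d. (subst_mat d \<sigma> ^\<^sub>m k) $$ (i, j) > 0)"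

definition dominant_eigenvalue :: "nat \<Rightarrow> (nat \<Rightarrow> nat list) \<Rightarrow> real" where
  "dominant_eigenvalue d \<sigma> = spectral_radius (map_mat of_nat (subst_mat d \<sigma>))"

definition substitutive_primitive :: "real \<Rightarrow> 'a stream \<Rightarrow> bool" where
  "substitutive_primitive \<theta> x \<longleftrightarrow>
     (\<exists>d \<sigma> y \<phi>. primitive_subst d \<sigma> \<and> dominant_eigenvalue d \<sigma> = \<theta> \<and>
        y \<in> streams {..<d} \<and> morph_seq \<sigma> y = y \<and> x = smap \<phi> y)"

end

theory Submission
  imports Defs "Berlekamp_Zassenhaus.Factor_Bound"
begin

hide_const (open) module.smult up_ring.coeff up_ring.monom

text \<open>
  Suppose that \<open>x\<close> is \<open>\<theta>\<close>-substitutive primitive and not periodic. Cut \<open>x\<close> into the images of the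
  letters under \<open>\<sigma>\<^sup>n\<close>, with \<open>n\<close> chosen so that these images have length comparable to \<open>m\<close>. By linear
  recurrence the prefix of length \<open>m\<close> occurs a bounded number of times in each block, a number which
  depends only on two consecutive letters, so the frequency of the prefix is \<open>\<theta>\<^sup>-\<^sup>n\<close> times an element
  of a fixed finite set. As \<open>x\<close> is not periodic, the prefix frequencies take infinitely many values.
  If these values also lie in finitely many geometric progressions of ratio \<open>1/\<beta>\<close>, then two of them
  lie in the same progression for \<open>\<alpha>\<close> and for \<open>\<beta>\<close>, and their quotient is both a power of \<open>\<alpha>\<close> and a
  power of \<open>\<beta>\<close>.

  Conversely, Lind's construction realises a Perron number \<open>\<alpha>\<close> as the dominant eigenvalue of a primitive
  substitution. It leaves enough freedom to have a letter whose image begins with itself and to make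
  all image lengths congruent to 1 modulo the period \<open>q\<close> of \<open>x\<close>; letters can then carry their position
  modulo \<open>q\<close>, from which \<open>x\<close> is read off.
\<close>

section \<open>Fixed points of primitive substitutions\<close>

text \<open>The dominant eigenvalue is reached through positive eigenvectors: a positive right or
  left eigenvector forces its eigenvalue to be the spectral radius. For a given substitution the
  vector is that of the letter frequencies, with eigenvalue the mean image length
  \<open>\<Lambda> 1\<close>, so the existence of frequencies has to come first. For the constructed
  substitution it is a family of weights carried by the letters, each a positive integer combination
  value times a power of \<alpha>. The bounded number of occurrences per block is where
  non-periodicity enters: two occurrences of a long prefix at a short distance would give that
  distance as a period of the whole sequence, since all short factors already appear in the prefix.
  Pairs of letters are needed because an occurrence may start in one block and end in the next. The
  Perron condition makes the coordinates of \<alpha>^k with respect to low powers of \<alpha>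
  converge after division by \<alpha>^k, so that everything but the dominant direction becomes
  negligible. Of its total \<alpha>^(M+1), a top letter of Lind's tower spends \<alpha>^M on itself;
  only the difference has to be decomposed.\<close>

lemma morph_word_simps [simp]:
  "morph_word \<sigma> [] = []"
  "morph_word \<sigma> (a # w) = \<sigma> a @ morph_word \<sigma> w"
  "morph_word \<sigma> (u @ v) = morph_word \<sigma> u @ morph_word \<sigma> v"
  by (simp_all add: morph_word_def)

lemma iter_Nil [simp]:
  fixes \<sigma> :: "'b \<Rightarrow> 'b list"
  shows "(morph_word \<sigma> ^^ n) [] = []"
  by (induction n) auto

lemma iter_append:
  fixes \<sigma> :: "'b \<Rightarrow> 'b list"
  shows "(morph_word \<sigma> ^^ n) (u @ v) = (morph_word \<sigma> ^^ n) u @ (morph_word \<sigma> ^^ n) v"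
  by (induction n) auto

lemma iter_Cons:
  fixes \<sigma> :: "'b \<Rightarrow> 'b list"
  shows "(morph_word \<sigma> ^^ n) (a # v) = (morph_word \<sigma> ^^ n) [a] @ (morph_word \<sigma> ^^ n) v"
  using iter_append[of n \<sigma> "[a]" v] by simp

lemma iter_Suc_letter:
  fixes \<sigma> :: "'b \<Rightarrow> 'b list"
  shows "(morph_word \<sigma> ^^ Suc n) [a] = (morph_word \<sigma> ^^ n) (\<sigma> a)"
  unfolding funpow_Suc_right by simp

lemma set_iter:
  fixes \<sigma> :: "'b \<Rightarrow> 'b list"
  shows "set ((morph_word \<sigma> ^^ n) w) = (\<Union>a\<in>set w. set ((morph_word \<sigma> ^^ n) [a]))"
  by (induction w) (simp, subst iter_Cons, simp)

lemma length_iter: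
  fixes \<sigma> :: "'b \<Rightarrow> 'b list"
  shows "length ((morph_word \<sigma> ^^ n) w) = (\<Sum>a\<leftarrow>w. length ((morph_word \<sigma> ^^ n) [a]))"
  by (induction w) (simp, subst iter_Cons, simp)

lemma count_iter:
  fixes \<sigma> :: "'b \<Rightarrow> 'b list"
  shows "count_list ((morph_word \<sigma> ^^ n) w) b = (\<Sum>a\<leftarrow>w. count_list ((morph_word \<sigma> ^^ n) [a]) b)"
  by (induction w) (simp, subst iter_Cons, simp)

lemma morph_seq_unfold:
  assumes "\<And>a. a \<in> sset y \<Longrightarrow> \<sigma> a \<noteq> []"
  shows "morph_seq \<sigma> y = morph_word \<sigma> (stake n y) @- morph_seq \<sigma> (sdrop n y)"
  using assms
proof (induction n arbitrary: y)
  case (Suc n)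
  have "\<sigma> (shd y) \<noteq> []" using Suc.prems shd_sset by blast
  then have "morph_seq \<sigma> y = \<sigma> (shd y) @- morph_seq \<sigma> (stl y)"
    unfolding morph_seq_def by (subst flat_unfold) (simp_all only: stream.map_sel not_False_eq_True)
  moreover have "\<And>a. a \<in> sset (stl y) \<Longrightarrow> \<sigma> a \<noteq> []" by (meson Suc.prems stl_sset)
  then have "morph_seq \<sigma> (stl y) = morph_word \<sigma> (stake n (stl y)) @- morph_seq \<sigma> (sdrop n (stl y))"
    by (rule Suc.IH)
  ultimately show ?case by (simp only: stake.simps sdrop.simps morph_word_simps shift_append)
qed simp

lemma stake_length_shift [simp]: "stake (length w) (w @- s) = w"
  by (simp add: stake_shift)

lemma stake_nth_eq: "stake n s = map (snth s) [0..<n]"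
  by (rule nth_equalityI) auto

lemma subst_mat_pow:
  assumes closed: "\<And>a. a < d \<Longrightarrow> set (\<sigma> a) \<subseteq> {..<d}" and "i < d" "j < d"
  shows "(subst_mat d \<sigma> ^\<^sub>m k) $$ (i, j) = count_list ((morph_word \<sigma> ^^ k) [j]) i"
  using assms(2,3)
proof (induction k arbitrary: i j)
  case (Suc k)
  have c: "subst_mat d \<sigma> ^\<^sub>m k \<in> carrier_mat d d" "subst_mat d \<sigma> \<in> carrier_mat d d"
    by (auto simp: subst_mat_def intro!: pow_carrier_mat)
  have "(subst_mat d \<sigma> ^\<^sub>m Suc k) $$ (i, j) = (\<Sum>c<d. (subst_mat d \<sigma> ^\<^sub>m k) $$ (i, c) * subst_mat d \<sigma> $$ (c, j))"
    using c Suc.prems by (simp add: scalar_prod_def atLeast0LessThan)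
  also have "\<dots> = (\<Sum>c<d. count_list ((morph_word \<sigma> ^^ k) [c]) i * count_list (\<sigma> j) c)"
    using Suc by (intro sum.cong) (auto simp: subst_mat_def)
  also have "\<dots> = (\<Sum>a\<leftarrow>\<sigma> j. count_list ((morph_word \<sigma> ^^ k) [a]) i)"
    using closed[OF Suc.prems(2)] 
    by (subst sum_list_map_eq_sum_count2[of "\<sigma> j" "{..<d}"]) (auto simp: mult.commute)
  also have "\<dots> = count_list ((morph_word \<sigma> ^^ Suc k) [j]) i"
    by (simp only: iter_Suc_letter count_iter[of k \<sigma> "\<sigma> j"])
  finally show ?case .
qed (auto simp: subst_mat_def)

section \<open>Block structure of a fixed point\<close>

locale primitive_fixed_point =
  fixes d :: nat and \<sigma> :: "nat \<Rightarrow> nat list" and y :: "nat stream"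
  assumes prim: "primitive_subst d \<sigma>"
    and y_in: "y \<in> streams {..<d}"
    and fixed: "morph_seq \<sigma> y = y"
begin

abbreviation T :: "nat \<Rightarrow> nat list \<Rightarrow> nat list" where "T n \<equiv> morph_word \<sigma> ^^ n"
abbreviation Y :: "nat \<Rightarrow> nat" where "Y i \<equiv> y !! i"
definition L :: "nat \<Rightarrow> nat \<Rightarrow> nat" where "L n a = length (T n [a])"

text \<open>\<open>p n j\<close> is the position at which the image of the \<open>j\<close>-th letter under \<open>\<sigma>\<^sup>n\<close> starts.\<close>
definition p :: "nat \<Rightarrow> nat \<Rightarrow> nat" where "p n j = length (T n (stake j y))"

lemma Y_less [simp]: "Y i < d"
  using y_in by (metis lessThan_iff snth_in)

lemma d_pos [simp]: "0 < d"
  using Y_less[of 0] by linarith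

lemma substitution: "substitution d \<sigma>"
  using prim by (simp add: primitive_subst_def)

lemma set_\<sigma>: "a < d \<Longrightarrow> set (\<sigma> a) \<subseteq> {..<d}"
  using substitution by (auto simp: substitution_def)

lemma set_T: "set w \<subseteq> {..<d} \<Longrightarrow> set (T n w) \<subseteq> {..<d}"
proof (induction n)
  case (Suc n)
  then have "set (T n w) \<subseteq> {..<d}" by blast
  then show ?case using set_\<sigma> by (fastforce simp: morph_word_def[of _ "T n w"])
qed simp

lemma L_tendsto: "a < d \<Longrightarrow> filterlim (\<lambda>n. L n a) at_top sequentially"
  using substitution by (auto simp: substitution_def L_def)

text \<open>All iterates of an erased letter are empty, against the growth condition.\<close>

lemma nonerasing: "a < d \<Longrightarrow> \<sigma> a \<noteq> []"
proof
  assume a: "a < d" and e: "\<sigma> a = []"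
  have "\<forall>\<^sub>F n in sequentially. 1 \<le> L n a"
    using L_tendsto[OF a] by (auto simp: filterlim_at_top)
  then obtain N where "\<And>n. n \<ge> N \<Longrightarrow> 1 \<le> L n a" by (auto simp: eventually_sequentially)
  then have "1 \<le> L (Suc N) a" by simp
  then show False using e by (simp add: L_def iter_Suc_letter del: funpow.simps)
qed

lemma T_ne: "set w \<subseteq> {..<d} \<Longrightarrow> w \<noteq> [] \<Longrightarrow> T n w \<noteq> []"
proof (induction n)
  case (Suc n)
  then have "T n w \<noteq> []" "set (T n w) \<subseteq> {..<d}" using set_T by auto
  then show ?case using nonerasing by (cases "T n w") auto
qed simp

lemma L_pos: "a < d \<Longrightarrow> 0 < L n a"
  using T_ne[of "[a]" n] by (simp add: L_def)

lemma sset_y: "a \<in> sset y \<Longrightarrow> a < d"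
  using y_in by (metis lessThan_iff streams_iff_sset subsetD)

text \<open>The fixed point equation is applied to a prefix that is already known to be an image of
  order \<open>n\<close>; its image under \<sigma> is again a prefix.\<close>

lemma T_stake: "stake (length (T n (stake j y))) y = T n (stake j y)"
proof (induction n arbitrary: j)
  case (Suc n)
  let ?w = "T n (stake j y)"
  have "y = morph_word \<sigma> (stake (length ?w) y) @- morph_seq \<sigma> (sdrop (length ?w) y)"
    using morph_seq_unfold[of y \<sigma> "length ?w"] nonerasing sset_y fixed by auto
  also have "stake (length ?w) y = ?w" using Suc by blast
  finally have "y = T (Suc n) (stake j y) @- morph_seq \<sigma> (sdrop (length ?w) y)" by simp
  then show ?case by (metis stake_length_shift)
qed simp

lemma stake_p: "stake (p n j) y = T n (stake j y)"
  unfolding p_def by (rule T_stake)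

lemma p_0 [simp]: "p n 0 = 0" by (simp add: p_def)

lemma p_Suc [simp]: "p n (Suc j) = p n j + L n (Y j)"
  unfolding p_def L_def stake_Suc iter_append by simp

lemma Y_block:
  assumes "r < L n (Y j)"
  shows "Y (p n j + r) = T n [Y j] ! r"
proof -
  have "stake (p n (Suc j)) y = stake (p n j) y @ T n [Y j]"
    by (simp only: stake_p stake_Suc iter_append)
  moreover have "Y (p n j + r) = stake (p n (Suc j)) y ! (p n j + r)"
    using assms by simp
  ultimately show ?thesis by (simp add: nth_append)
qed

text \<open>The cuttings are nested: a block boundary of order \<open>m + n\<close> is the boundary
  of order \<open>m\<close> with index \<open>p n j\<close>. All arguments that compare two scales
  rest on this.\<close>

lemma p_add: "p (m + n) j = p m (p n j)"
proof -
  have "T (m + n) (stake j y) = T m (T n (stake j y))" by (simp add: funpow_add)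
  then show ?thesis using stake_p[of n j] by (simp add: p_def)
qed

lemma p_sum: "p n J = (\<Sum>j<J. L n (Y j))"
  by (induction J) auto

lemma p_mono_strict: "strict_mono (p n)"
  using L_pos by (auto simp: strict_mono_Suc_iff)

lemma p_mono: "i \<le> j \<Longrightarrow> p n i \<le> p n j"
  using p_mono_strict by (simp add: strict_mono_less_eq)

lemma block_of: "\<exists>j. p n j \<le> i \<and> i < p n (Suc j)"
proof -
  have *: "i < p n (Suc i)" using strict_mono_imp_increasing[OF p_mono_strict, of "Suc i" n] by linarith
  define j where "j = (LEAST j. i < p n (Suc j))"
  have "i < p n (Suc j)" unfolding j_def by (rule LeastI, rule *)
  moreover have "p n j \<le> i"
  proof (cases j)
    case (Suc j')
    then have "\<not> i < p n (Suc j')" using not_less_Least[of j' "\<lambda>j. i < p n (Suc j)"] unfolding j_def by simp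
    then show ?thesis using Suc by simp
  qed simp
  ultimately show ?thesis by blast
qed

lemma sum_blocks:
  fixes g :: "nat \<Rightarrow> real"
  shows "(\<Sum>i<p n J. g i) = (\<Sum>j<J. \<Sum>i=p n j..<p n (Suc j). g i)"
proof (induction J)
  case (Suc J)
  have "(\<Sum>i<p n (Suc J). g i) = (\<Sum>i<p n J. g i) + (\<Sum>i=p n J..<p n (Suc J). g i)"
    unfolding lessThan_atLeast0 by (rule sum.atLeastLessThan_concat[symmetric]) (auto intro: p_mono)
  then show ?case unfolding sum.lessThan_Suc Suc.IH .
qed simp

definition K :: nat where "K = (SOME k. 0 < k \<and> (\<forall>a<d. \<forall>b<d. b \<in> set (T k [a])))"

lemma K: "0 < K" "a < d \<Longrightarrow> b < d \<Longrightarrow> b \<in> set (T K [a])"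
proof -
  obtain k where "k > 0" "\<forall>i<d. \<forall>j<d. (subst_mat d \<sigma> ^\<^sub>m k) $$ (i, j) > 0"
    using prim by (auto simp: primitive_subst_def)
  moreover have "b \<in> set (T k [a])" if "a < d" "b < d" for a b
  proof -
    have "0 < (subst_mat d \<sigma> ^\<^sub>m k) $$ (b, a)" using calculation(2) that by blast
    also have "\<dots> = count_list (T k [a]) b" by (rule subst_mat_pow[OF set_\<sigma> that(2,1)])
    finally show ?thesis using count_list_0_iff[of "T k [a]" b] by linarith
  qed
  ultimately have "0 < k \<and> (\<forall>a<d. \<forall>b<d. b \<in> set (T k [a]))" by blast
  then have "0 < K \<and> (\<forall>a<d. \<forall>b<d. b \<in> set (T K [a]))" unfolding K_def by (rule someI)
  then show "0 < K" "a < d \<Longrightarrow> b < d \<Longrightarrow> b \<in> set (T K [a])" by auto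
qed

text \<open>\<open>V\<close> will bound the ratio of the lengths of two blocks of equal order,
  \<open>W\<close> the growth of a block from one order to the next.\<close>

definition V :: nat where "V = (\<Sum>a<d. L K a)"
definition W :: nat where "W = (\<Sum>a<d. L 1 a)"

lemma L_add: "L (m + n) a = (\<Sum>b\<leftarrow>T n [a]. L m b)"
  by (simp add: L_def funpow_add length_iter[of m \<sigma> "T n [a]"] del: funpow.simps)

lemma L_add_le:
  assumes "a < d"
  shows "L (m + n) a \<le> (\<Sum>b<d. L m b) * L n a"
proof -
  have "L m b \<le> (\<Sum>b<d. L m b)" if "b \<in> set (T n [a])" for b
    using set_T[of "[a]" n] that assms by (intro member_le_sum) auto
  then have "(\<Sum>b\<leftarrow>T n [a]. L m b) \<le> (\<Sum>b\<leftarrow>T n [a]. (\<Sum>b<d. L m b))"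
    by (intro sum_list_mono)
  also have "\<dots> = (\<Sum>b<d. L m b) * L n a" by (simp add: sum_list_triv L_def)
  finally show ?thesis by (simp add: L_add)
qed

lemma L_le_add:
  assumes "a \<in> set (T n [c])" shows "L m a \<le> L (m + n) c"
  unfolding L_add by (rule member_le_sum_list) (use assms in auto)

lemma L_Suc_le: "a < d \<Longrightarrow> L (Suc n) a \<le> W * L n a"
  using L_add_le[of a 1 n] by (simp add: W_def)

lemma L_compare_add: "a < d \<Longrightarrow> c < d \<Longrightarrow> L (n + K) a \<le> V * V * L n c"
proof -
  assume a: "a < d" and c: "c < d"
  have "L (n + K) a = L (K + n) a" by (simp add: add.commute)
  also have "\<dots> \<le> V * L n a" using L_add_le[of a K n] a by (simp add: V_def)
  also have "L n a \<le> L (n + K) c" using L_le_add K(2) a c by blast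
  also have "L (n + K) c \<le> V * L n c" using L_add_le[of c K n] c by (simp add: V_def add.commute)
  finally show ?thesis by (simp add: mult.assoc)
qed

text \<open>The letter \<open>a\<close> occurs in the image of \<open>c\<close> of order
  \<open>K\<close>, so the block of \<open>a\<close> sits inside the block of \<open>c\<close> of
  order \<open>n + K\<close>, which is at most \<open>V\<close> times as long as that of order
  \<open>n\<close>.\<close>

lemma L_compare: "a < d \<Longrightarrow> c < d \<Longrightarrow> L n a \<le> V * L n c"
proof -
  assume a: "a < d" and c: "c < d"
  have "L n a \<le> L (n + K) c" using L_le_add K(2) a c by blast
  also have "L (n + K) c \<le> V * L n c" using L_add_le[of c K n] c by (simp add: V_def add.commute)
  finally show ?thesis .
qed

lemma L_unbounded: "\<exists>n\<ge>n0. \<forall>a<d. m \<le> L n a"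
proof -
  have "\<forall>\<^sub>F n in sequentially. \<forall>a\<in>{..<d}. m \<le> L n a"
    using L_tendsto by (intro eventually_ball_finite) (auto simp: filterlim_at_top)
  then obtain N where "\<forall>n\<ge>N. \<forall>a<d. m \<le> L n a" by (auto simp: eventually_sequentially)
  then have "max N n0 \<ge> n0 \<and> (\<forall>a<d. m \<le> L (max N n0) a)" by simp
  then show ?thesis by blast
qed

lemma block_contains:
  assumes "c < d"
  shows "\<exists>i. p K j \<le> i \<and> i < p K (Suc j) \<and> Y i = c"
proof -
  obtain r where "r < L K (Y j)" "T K [Y j] ! r = c"
    using K(2)[OF Y_less assms, of j] unfolding in_set_conv_nth L_def by blast
  then have "p K j \<le> p K j + r \<and> p K j + r < p K (Suc j) \<and> Y (p K j + r) = c"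
    using Y_block[of r K j] by simp
  then show ?thesis by blast
qed

lemma block_eq:
  assumes "Y j = Y j'" "r < L n (Y j)"
  shows "Y (p n j + r) = Y (p n j' + r)"
  using Y_block[of r n j] Y_block[of r n j'] assms by metis

text \<open>A window that starts in a block and is no longer than the next block stays inside two
  consecutive blocks, hence is determined by two letters and the offset.\<close>

lemma two_blocks_eq:
  assumes "Y j = Y j'" "Y (Suc j) = Y (Suc j')" "p n j + r < p n (Suc (Suc j))"
  shows "Y (p n j + r) = Y (p n j' + r)"
proof (cases "r < L n (Y j)")
  case False
  then obtain s where s: "r = L n (Y j) + s" using le_Suc_ex[of "L n (Y j)" r] by force
  with assms(3) have "s < L n (Y (Suc j))" by simp
  then have "Y (p n (Suc j) + s) = Y (p n (Suc j') + s)"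
    by (rule block_eq[OF assms(2)])
  then show ?thesis using assms(1) by (simp add: s add.assoc)
qed (rule block_eq[OF assms(1)])

end

declare snth.simps [simp del]

section \<open>Frequencies\<close>

definition avg :: "(nat \<Rightarrow> real) \<Rightarrow> nat \<Rightarrow> real" where
  "avg g N = (\<Sum>i<N. g i) / real N"

context primitive_fixed_point
begin

lemma sum_blocks_from:
  fixes g :: "nat \<Rightarrow> real"
  assumes "a \<le> b"
  shows "(\<Sum>i=p n a..<p n b. g i) = (\<Sum>t=a..<b. \<Sum>i=p n t..<p n (Suc t). g i)"
  using assms
proof (induction b rule: dec_induct)
  case (step b)
  have "(\<Sum>i=p n a..<p n (Suc b). g i) = (\<Sum>i=p n a..<p n b. g i) + (\<Sum>i=p n b..<p n (Suc b). g i)"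
    using step by (intro sum.atLeastLessThan_concat[symmetric]) (auto intro: p_mono)
  then show ?case using step by (simp del: p_Suc)
qed simp

lemma V_pos: "0 < V"
  using L_pos[of 0 K] by (auto simp: V_def intro!: sum_pos2[of _ 0])

text \<open>Every block of order \<open>n + K\<close> contains a block of order \<open>n\<close> of the fixed type \<open>Y 0\<close>, of comparable
  length. Its mean lies in the lower or in the upper half of any interval that contains all means of
  order \<open>n\<close>, so that one of the two ends of the interval can be improved at order \<open>n + K\<close>.\<close>
lemma mean_exists:
  fixes g :: "nat \<Rightarrow> real"
  assumes g01: "\<And>i. 0 \<le> g i" "\<And>i. g i \<le> 1"
    and E: "\<And>n j j'. Y j = Y j' \<Longrightarrow>
      \<bar>(\<Sum>i=p n j..<p n (Suc j). g i) - (\<Sum>i=p n j'..<p n (Suc j'). g i)\<bar> \<le> E"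
  shows "\<exists>q. avg g \<longlonglongrightarrow> q"
proof -
  define G where "G n j = (\<Sum>i=p n j..<p n (Suc j). g i)" for n j
  \<comment> \<open>All block means of order \<open>n\<close> lie in the interval from
    \<open>lo\<close> to \<open>hi\<close>; by nesting the property is inherited by all higher
    orders.\<close>
  define bracket where "bracket n lo hi \<longleftrightarrow>
    (\<forall>j. lo * real (L n (Y j)) \<le> G n j \<and> G n j \<le> hi * real (L n (Y j)))" for n lo hi
  have E0: "0 \<le> E" using E[of 0 0 0] by simp
  have GE: "\<bar>G n j - G n j'\<bar> \<le> E" if "Y j = Y j'" for n j j'
    using E[OF that] by (simp add: G_def del: p_Suc)
  have G_add: "G (n + k) j = (\<Sum>t=p k j..<p k (Suc j). G n t)" for n k j
    unfolding G_def p_add by (rule sum_blocks_from) (rule p_mono, simp)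
  have L_add': "real (L (n + k) (Y j)) = (\<Sum>t=p k j..<p k (Suc j). real (L n (Y t)))" for n k j
  proof -
    have "real (L (n + k) (Y j)) = (\<Sum>i=p (n+k) j..<p (n+k) (Suc j). 1::real)" by simp
    also have "\<dots> = (\<Sum>t=p k j..<p k (Suc j). \<Sum>i=p n t..<p n (Suc t). 1::real)"
      unfolding p_add by (rule sum_blocks_from) (rule p_mono, simp)
    finally show ?thesis by simp
  qed
  have bracket_add: "bracket (n + k) lo hi" if "bracket n lo hi" for n k lo hi
    unfolding bracket_def G_add L_add' sum_distrib_left
    using that by (auto intro!: sum_mono simp: bracket_def simp del: p_Suc)
  have bracket0: "bracket 0 0 1"
    using g01 by (auto simp: bracket_def G_def L_def intro!: sum_nonneg order.trans[OF sum_bounded_above[where K=1]])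
  \<comment> \<open>A block of type \<open>Y 0\<close> fills at least the fraction
    \<open>4 * \<delta>\<close> of a block of order \<open>n + K\<close>. Improving its mean by half
    the width gains \<open>2 * \<delta>\<close> times the width; one \<delta> pays for the error
    \<open>E\<close>, the other remains.\<close>
  define \<delta> where "\<delta> = 1 / (4 * (real V)\<^sup>2)"
  have V: "real V \<ge> 1" using V_pos by simp
  have V2: "(real V)\<^sup>2 \<ge> 1" using V by (simp add: one_le_power)
  have \<delta>: "0 < \<delta>" "\<delta> \<le> 1" using V2 V_pos by (auto simp: \<delta>_def divide_simps intro: order.trans[OF V2])
  have improve: "\<exists>n' lo' hi'. bracket n' lo' hi' \<and> hi' - lo' \<le> (1 - \<delta>) * (hi - lo)"
    if br: "bracket n0 lo hi" and big: "hi - lo \<ge> \<epsilon>" and \<epsilon>: "\<epsilon> > 0" for n0 lo hi \<epsilon>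
  proof -
    define D where "D = hi - lo"
    define h where "h = D / 2"
    have hi: "hi = lo + h + h" and D2: "D = h + h" by (simp_all add: D_def h_def)
    \<comment> \<open>The order is taken so large that \<open>E\<close>, the difference between two
      blocks of the same type, is at most \<open>\<delta> * D\<close> times the length of a block of
      order \<open>n + K\<close>.\<close>
    define m where "m = nat \<lceil>E / (\<delta> * D)\<rceil>"
    obtain n where n: "n \<ge> n0" "\<And>a. a < d \<Longrightarrow> m \<le> L n a" using L_unbounded by meson
    have br: "bracket n lo hi" using bracket_add[OF br, of "n - n0"] n by simp
    have D: "D > 0" using big \<epsilon> by (simp add: D_def)
    let ?c = "Y 0"
    have c_ge: "4 * \<delta> * real (L (n + K) (Y j)) \<le> real (L n ?c)" for j
    proof -
      have "real (L (n + K) (Y j)) \<le> (real V)\<^sup>2 * real (L n ?c)"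
        using L_compare_add[of "Y j" ?c n] unfolding power2_eq_square
        by (metis Y_less of_nat_le_iff of_nat_mult)
      then show ?thesis using V2 by (simp add: \<delta>_def divide_simps mult.commute)
    qed
    have E_le: "E \<le> \<delta> * D * real (L (n + K) (Y j))" for j
    proof -
      have "m \<le> L n (Y (p K j))" using n(2) by simp
      also have "\<dots> \<le> L (n + K) (Y j)"
        using L_le_add K(2) by simp
      finally have "E / (\<delta> * D) \<le> real (L (n + K) (Y j))"
        unfolding m_def by linarith
      then show ?thesis using \<delta> D by (simp add: divide_simps mult.commute)
    qed
    have split: "\<exists>t0. Y t0 = ?c \<and> t0 \<in> {p K j..<p K (Suc j)}" for j
      using block_contains[of ?c j] by (auto simp del: p_Suc)
    show ?thesis
    proof (cases "G n 0 \<le> (lo + h) * real (L n ?c)")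
      case True
      have up: "G (n + K) j \<le> (hi - \<delta> * D) * real (L (n + K) (Y j))" for j
      proof -
        obtain t0 where t0: "Y t0 = ?c" "t0 \<in> {p K j..<p K (Suc j)}" using split by blast
        let ?S = "{p K j..<p K (Suc j)} - {t0}"
        have "G (n + K) j = G n t0 + (\<Sum>t\<in>?S. G n t)"
          unfolding G_add using t0(2) by (subst sum.remove[of _ t0]) simp_all
        also have "G n t0 \<le> (lo + h) * real (L n ?c) + E" using GE[OF t0(1), of n] True by linarith
        also have "(\<Sum>t\<in>?S. G n t) \<le> (\<Sum>t\<in>?S. hi * real (L n (Y t)))"
          using br by (intro sum_mono) (simp add: bracket_def)
        also have "(\<Sum>t\<in>?S. hi * real (L n (Y t))) = hi * (real (L (n + K) (Y j)) - real (L n ?c))"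
          unfolding L_add' sum_distrib_left[symmetric] using t0
          by (subst (2) sum.remove[of _ t0]) simp_all
        finally have "G (n + K) j \<le> hi * real (L (n + K) (Y j)) - h * real (L n ?c) + E"
          by (simp add: hi algebra_simps)
        also have "\<dots> \<le> hi * real (L (n + K) (Y j)) - h * (4 * \<delta> * real (L (n + K) (Y j)))
            + \<delta> * D * real (L (n + K) (Y j))"
          using mult_left_mono[OF c_ge[of j], of h] E_le[of j] D D2 by linarith
        finally show ?thesis by (simp add: D2 algebra_simps)
      qed
      have "bracket (n + K) lo (hi - \<delta> * D)"
        using bracket_add[OF br, of K] up by (simp add: bracket_def)
      then show ?thesis by (intro exI[of _ "n + K"] exI[of _ lo] exI[of _ "hi - \<delta> * D"])
          (simp add: D_def algebra_simps)
    next
      case False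
      have low: "G (n + K) j \<ge> (lo + \<delta> * D) * real (L (n + K) (Y j))" for j
      proof -
        obtain t0 where t0: "Y t0 = ?c" "t0 \<in> {p K j..<p K (Suc j)}" using split by blast
        let ?S = "{p K j..<p K (Suc j)} - {t0}"
        have e1: "G (n + K) j = G n t0 + (\<Sum>t\<in>?S. G n t)"
          unfolding G_add using t0(2) by (subst sum.remove[of _ t0]) simp_all
        have e2: "G n t0 \<ge> (lo + h) * real (L n ?c) - E" using GE[OF t0(1), of n] False by linarith
        have e3: "(\<Sum>t\<in>?S. G n t) \<ge> (\<Sum>t\<in>?S. lo * real (L n (Y t)))"
          using br by (intro sum_mono) (simp add: bracket_def)
        have e4: "(\<Sum>t\<in>?S. lo * real (L n (Y t))) = lo * (real (L (n + K) (Y j)) - real (L n ?c))"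
          unfolding L_add' sum_distrib_left[symmetric] using t0
          by (subst (2) sum.remove[of _ t0]) simp_all
        have "lo * real (L (n + K) (Y j)) + h * (4 * \<delta> * real (L (n + K) (Y j)))
            - \<delta> * D * real (L (n + K) (Y j)) \<le> lo * real (L (n + K) (Y j)) + h * real (L n ?c) - E"
          using mult_left_mono[OF c_ge[of j], of h] E_le[of j] D D2 by linarith
        also have "\<dots> \<le> G (n + K) j"
          using e1 e2 e3 e4 by (simp add: algebra_simps)
        finally show ?thesis by (simp add: D2 algebra_simps)
      qed
      have "bracket (n + K) (lo + \<delta> * D) hi"
        using bracket_add[OF br, of K] low by (simp add: bracket_def)
      then show ?thesis by (intro exI[of _ "n + K"] exI[of _ "lo + \<delta> * D"] exI[of _ hi])
          (simp add: D_def algebra_simps)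
    qed
  qed
  \<comment> \<open>The required order depends on a lower bound for the width, so the iteration
    stops once the width is below \<epsilon>; this is what the maximum records.\<close>
  have narrow: "\<exists>n lo hi. bracket n lo hi \<and> hi - lo \<le> max \<epsilon> ((1 - \<delta>) ^ i)" if "\<epsilon> > 0" for \<epsilon> i
  proof (induction i)
    case 0
    show ?case using bracket0 by (intro exI[of _ 0] exI[of _ "0::real"] exI[of _ "1::real"]) auto
  next
    case (Suc i)
    then obtain n lo hi where b: "bracket n lo hi" "hi - lo \<le> max \<epsilon> ((1 - \<delta>) ^ i)" by blast
    show ?case
    proof (cases "hi - lo \<ge> \<epsilon> \<and> \<epsilon> < (1 - \<delta>) ^ i")
      case True
      then obtain n' lo' hi' where b': "bracket n' lo' hi'" "hi' - lo' \<le> (1 - \<delta>) * (hi - lo)"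
        using improve[OF b(1)] \<open>\<epsilon> > 0\<close> by blast
      have "(1 - \<delta>) * (hi - lo) \<le> (1 - \<delta>) * (1 - \<delta>) ^ i"
        using True b \<delta> by (intro mult_left_mono) auto
      with b' show ?thesis by (intro exI[of _ n'] exI[of _ lo'] exI[of _ hi']) auto
    next
      case False
      then show ?thesis using b by (intro exI[of _ n] exI[of _ lo] exI[of _ hi]) auto
    qed
  qed
  have close: "\<exists>lo. \<forall>\<^sub>F N in sequentially. \<bar>avg g N - lo\<bar> \<le> 2 * \<epsilon>" if \<epsilon>: "\<epsilon> > 0" for \<epsilon>
  proof -
    have "(\<lambda>i. (1 - \<delta>) ^ i) \<longlonglongrightarrow> 0" using \<delta> by (intro LIMSEQ_realpow_zero) auto
    then have "\<forall>\<^sub>F i in sequentially. (1 - \<delta>) ^ i < \<epsilon>" using \<epsilon> by (rule order_tendstoD)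
    then obtain i where "(1 - \<delta>) ^ i < \<epsilon>" by (auto simp: eventually_sequentially)
    then obtain n lo hi where b: "bracket n lo hi" "hi - lo \<le> \<epsilon>"
      using narrow[OF \<epsilon>, of i] by (auto simp: max_def split: if_splits)
    define C where "C = real (\<Sum>a<d. L n a)"
    have LC: "real (L n (Y j)) \<le> C" for j
      unfolding C_def of_nat_le_iff by (intro member_le_sum) auto
    \<comment> \<open>The incomplete last block contributes at most \<open>C\<close> to the sum, and
      replacing \<open>N\<close> by the last block boundary changes the linear terms by at most
      \<open>C\<close> times the slopes.\<close>
    have main: "lo * real N - (\<bar>lo\<bar> + \<bar>hi\<bar> + 1) * C \<le> (\<Sum>i<N. g i)"
        "(\<Sum>i<N. g i) \<le> hi * real N + (\<bar>lo\<bar> + \<bar>hi\<bar> + 1) * C" for N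
    proof -
      obtain j where j: "p n j \<le> N" "N < p n (Suc j)" using block_of by blast
      have "(\<Sum>i<N. g i) = (\<Sum>i<p n j. g i) + (\<Sum>i=p n j..<N. g i)"
        unfolding lessThan_atLeast0 using j by (intro sum.atLeastLessThan_concat[symmetric]) auto
      moreover have "(\<Sum>i<p n j. g i) = (\<Sum>t<j. G n t)" unfolding sum_blocks G_def ..
      moreover have "(\<Sum>t<j. G n t) \<le> (\<Sum>t<j. hi * real (L n (Y t)))"
        "(\<Sum>t<j. lo * real (L n (Y t))) \<le> (\<Sum>t<j. G n t)"
        using b(1) by (auto intro!: sum_mono simp: bracket_def)
      moreover have "(\<Sum>t<j. lo * real (L n (Y t))) = lo * real (p n j)"
        "(\<Sum>t<j. hi * real (L n (Y t))) = hi * real (p n j)"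
        by (simp_all add: p_sum sum_distrib_left)
      moreover have "0 \<le> (\<Sum>i=p n j..<N. g i)" using g01 by (intro sum_nonneg)
      moreover have "(\<Sum>i=p n j..<N. g i) \<le> C"
      proof -
        have "(\<Sum>i=p n j..<N. g i) \<le> real (N - p n j)"
          using sum_bounded_above[of "{p n j..<N}" g 1] g01 by simp
        also have "\<dots> \<le> C" using j LC[of j] by simp
        finally show ?thesis .
      qed
      moreover have "\<bar>lo * real (p n j) - lo * real N\<bar> \<le> \<bar>lo\<bar> * C" "\<bar>hi * real (p n j) - hi * real N\<bar> \<le> \<bar>hi\<bar> * C"
      proof -
        have "\<bar>real (p n j) - real N\<bar> \<le> C" using j LC[of j] by simp
        then show "\<bar>lo * real (p n j) - lo * real N\<bar> \<le> \<bar>lo\<bar> * C" "\<bar>hi * real (p n j) - hi * real N\<bar> \<le> \<bar>hi\<bar> * C"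
          by (auto simp flip: right_diff_distrib simp: abs_mult intro: mult_left_mono)
      qed
      moreover have "0 \<le> \<bar>lo\<bar> * C" "0 \<le> \<bar>hi\<bar> * C" "0 \<le> C" by (auto simp: C_def simp del: of_nat_sum)
      ultimately show "lo * real N - (\<bar>lo\<bar> + \<bar>hi\<bar> + 1) * C \<le> (\<Sum>i<N. g i)"
        "(\<Sum>i<N. g i) \<le> hi * real N + (\<bar>lo\<bar> + \<bar>hi\<bar> + 1) * C"
        unfolding distrib_right mult_1_left by - linarith+
    qed
    define B where "B = (\<bar>lo\<bar> + \<bar>hi\<bar> + 1) * C"
    have "(\<lambda>N. B / real N) \<longlonglongrightarrow> 0" by (rule lim_const_over_n)
    then have "\<forall>\<^sub>F N in sequentially. B / real N < \<epsilon>" using \<epsilon> by (rule order_tendstoD)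
    then have "\<forall>\<^sub>F N in sequentially. \<bar>avg g N - lo\<bar> \<le> 2 * \<epsilon>"
      using eventually_gt_at_top[of 0]
    proof eventually_elim
      case (elim N)
      have "avg g N \<ge> lo - B / real N" "avg g N \<le> hi + B / real N"
        using main[of N, folded B_def] elim(2)
        by (auto simp: avg_def pos_le_divide_eq pos_divide_le_eq left_diff_distrib distrib_right)
      then show ?case using elim(1) b(2) by linarith
    qed
    then show ?thesis by blast
  qed
  have "Cauchy (avg g)"
  proof (rule metric_CauchyI)
    fix e :: real assume "e > 0"
    then obtain lo where "\<forall>\<^sub>F N in sequentially. \<bar>avg g N - lo\<bar> \<le> 2 * (e / 6)" using close[of "e/6"] by auto
    then obtain M where M: "\<And>N. N \<ge> M \<Longrightarrow> \<bar>avg g N - lo\<bar> \<le> 2 * (e / 6)" by (auto simp: eventually_sequentially)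
    have "dist (avg g i) (avg g j) < e" if "i \<ge> M" "j \<ge> M" for i j
      using M[OF that(1)] M[OF that(2)] \<open>e > 0\<close> unfolding dist_real_def by linarith
    then show "\<exists>M. \<forall>i\<ge>M. \<forall>j\<ge>M. dist (avg g i) (avg g j) < e" by blast
  qed
  then show ?thesis by (simp add: Cauchy_convergent_iff convergent_def)
qed

lemma block_sum_shift:
  fixes g :: "nat \<Rightarrow> real"
  shows "(\<Sum>i=p n j..<p n (Suc j). g i) = (\<Sum>r<L n (Y j). g (p n j + r))"
  using sum.shift_bounds_nat_ivl[of g 0 "p n j" "L n (Y j)"]
  by (simp add: lessThan_atLeast0 add.commute)

text \<open>Two blocks of the same letter agree on every window that stays inside them. Only the
  last positions, at most \<open>m\<close> of them, see beyond the block, so the block sums differ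
  by at most \<open>m\<close> at every order.\<close>

lemma window_mean_exists:
  fixes g :: "nat \<Rightarrow> real"
  assumes g01: "\<And>i. 0 \<le> g i" "\<And>i. g i \<le> 1"
    and window: "\<And>i i'. (\<And>t. t < m \<Longrightarrow> Y (i + t) = Y (i' + t)) \<Longrightarrow> g i = g i'"
  shows "\<exists>q. avg g \<longlonglongrightarrow> q"
proof (rule mean_exists[OF g01])
  fix n j j' assume eq: "Y j = Y j'"
  let ?L = "L n (Y j)"
  have "\<bar>(\<Sum>r<?L. g (p n j + r)) - (\<Sum>r<?L. g (p n j' + r))\<bar>
      \<le> (\<Sum>r<?L. \<bar>g (p n j + r) - g (p n j' + r)\<bar>)"
    unfolding sum_subtractf[symmetric] by (rule sum_abs)
  also have "\<dots> \<le> (\<Sum>r<?L. of_bool (?L < r + m))"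
  proof (rule sum_mono)
    fix r assume "r \<in> {..<?L}"
    show "\<bar>g (p n j + r) - g (p n j' + r)\<bar> \<le> of_bool (?L < r + m)"
    proof (cases "?L < r + m")
      case True
      then show ?thesis using g01[of "p n j + r"] g01[of "p n j' + r"] by simp
    next
      case False
      have "g (p n j + r) = g (p n j' + r)"
        unfolding add.assoc[symmetric]
      proof (rule window)
        fix t assume "t < m"
        with False have "r + t < ?L" by linarith
        then show "Y (p n j + r + t) = Y (p n j' + r + t)"
          using block_eq[OF eq] by (simp add: add.assoc)
      qed
      then show ?thesis by simp
    qed
  qed
  also have "\<dots> = real (card {r. r < ?L \<and> ?L < r + m})"
    by (simp add: of_bool_def sum.If_cases Collect_conj_eq lessThan_def)
  also have "\<dots> \<le> real m"
  proof -
    have "{r. r < ?L \<and> ?L < r + m} \<subseteq> {?L - m..<?L}" by auto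
    then have "card {r. r < ?L \<and> ?L < r + m} \<le> card {?L - m..<?L}" by (intro card_mono) auto
    then show ?thesis by simp
  qed
  finally show "\<bar>(\<Sum>i=p n j..<p n (Suc j). g i) - (\<Sum>i=p n j'..<p n (Suc j'). g i)\<bar> \<le> real m"
    unfolding block_sum_shift using eq by simp
qed

section \<open>Means over letters and pairs of letters\<close>

definition pair_freq :: "nat \<Rightarrow> nat \<Rightarrow> real" where
  "pair_freq a b = lim (avg (\<lambda>i. of_bool (Y i = a \<and> Y (Suc i) = b)))"

lemma pair_freq: "avg (\<lambda>i. of_bool (Y i = a \<and> Y (Suc i) = b)) \<longlonglongrightarrow> pair_freq a b"
proof -
  have "\<exists>q. avg (\<lambda>i. of_bool (Y i = a \<and> Y (Suc i) = b)) \<longlonglongrightarrow> q"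
  proof (rule window_mean_exists[where m = 2])
    fix i i' assume "\<And>t. t < 2 \<Longrightarrow> Y (i + t) = Y (i' + t)"
    from this[of 0] this[of 1]
    show "(of_bool (Y i = a \<and> Y (Suc i) = b)::real) = of_bool (Y i' = a \<and> Y (Suc i') = b)" by simp
  qed auto
  then show ?thesis unfolding pair_freq_def by (auto simp: limI)
qed

definition pair_mean :: "(nat \<Rightarrow> nat \<Rightarrow> real) \<Rightarrow> real" where
  "pair_mean h = (\<Sum>a<d. \<Sum>b<d. h a b * pair_freq a b)"

lemma pair_mean: "avg (\<lambda>i. h (Y i) (Y (Suc i))) \<longlonglongrightarrow> pair_mean h"
proof -
  have *: "h (Y i) (Y (Suc i)) = (\<Sum>a<d. \<Sum>b<d. h a b * of_bool (Y i = a \<and> Y (Suc i) = b))" for i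
  proof -
    have "(\<Sum>a<d. \<Sum>b<d. h a b * of_bool (Y i = a \<and> Y (Suc i) = b))
        = (\<Sum>a<d. if a = Y i then h a (Y (Suc i)) else 0)"
      by (intro sum.cong refl) (auto simp: of_bool_def if_distrib sum.delta' cong: if_cong)
    then show ?thesis by simp
  qed
  have "avg (\<lambda>i. h (Y i) (Y (Suc i))) N
      = (\<Sum>a<d. \<Sum>b<d. h a b * avg (\<lambda>i. of_bool (Y i = a \<and> Y (Suc i) = b)) N)" for N
  proof -
    have "(\<Sum>i<N. h (Y i) (Y (Suc i))) = (\<Sum>a<d. \<Sum>i<N. \<Sum>b<d. h a b * of_bool (Y i = a \<and> Y (Suc i) = b))"
      unfolding * by (rule sum.swap)
    also have "\<dots> = (\<Sum>a<d. \<Sum>b<d. \<Sum>i<N. h a b * of_bool (Y i = a \<and> Y (Suc i) = b))"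
      by (rule sum.cong[OF refl], rule sum.swap)
    finally show ?thesis by (simp only: avg_def sum_distrib_left sum_divide_distrib times_divide_eq_right)
  qed
  then have "avg (\<lambda>i. h (Y i) (Y (Suc i)))
      = (\<lambda>N. \<Sum>a<d. \<Sum>b<d. h a b * avg (\<lambda>i. of_bool (Y i = a \<and> Y (Suc i) = b)) N)" by blast
  then show ?thesis unfolding pair_mean_def
    by (simp only:) (intro tendsto_intros pair_freq)
qed

lemma filterlim_p: "filterlim (p n) at_top sequentially"
  by (rule filterlim_subseq[OF p_mono_strict])

text \<open>The mean length of a block of order \<open>n\<close>; \<open>\<Lambda> 1\<close> will be
  the dominant eigenvalue.\<close>

definition \<Lambda> :: "nat \<Rightarrow> real" where "\<Lambda> n = pair_mean (\<lambda>a b. real (L n a))"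

lemma p_tendsto: "(\<lambda>J. real (p n J) / real J) \<longlonglongrightarrow> \<Lambda> n"
  using pair_mean[of "\<lambda>a b. real (L n a)"] by (simp add: avg_def[abs_def] \<Lambda>_def p_sum)

lemma \<Lambda>_ge_1: "\<Lambda> n \<ge> 1"
proof (rule LIMSEQ_le_const[OF p_tendsto])
  have "1 \<le> real (p n J) / real J" if "J \<ge> 1" for J
    using that strict_mono_imp_increasing[OF p_mono_strict, of J n] by (simp add: divide_simps)
  then show "\<exists>N. \<forall>J\<ge>N. 1 \<le> real (p n J) / real J" by blast
qed

text \<open>Passes from the mean per position to the mean per block of order \<open>n\<close>;
  \<open>\<Lambda> n\<close> is the number of positions per block. Evaluating the same sum in two
  ways through this lemma gives the multiplicativity of \<Lambda>, the eigenvector equation and the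
  formula for prefix frequencies.\<close>

lemma avg_p:
  assumes "avg g \<longlonglongrightarrow> q"
  shows "(\<lambda>J. (\<Sum>i<p n J. g i) / real J) \<longlonglongrightarrow> q * \<Lambda> n"
proof -
  have "(\<lambda>J. avg g (p n J) * (real (p n J) / real J)) \<longlonglongrightarrow> q * \<Lambda> n"
    by (intro tendsto_mult p_tendsto filterlim_compose[OF assms filterlim_p])
  moreover have "\<forall>\<^sub>F J in sequentially. avg g (p n J) * (real (p n J) / real J) = (\<Sum>i<p n J. g i) / real J"
    using eventually_gt_at_top[of 0]
  proof eventually_elim
    case (elim J)
    then have "p n J > 0" using strict_mono_imp_increasing[OF p_mono_strict, of J n] by linarith
    then show ?case by (simp add: avg_def)
  qed
  ultimately show ?thesis by (rule Lim_transform_eventually)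
qed

lemma \<Lambda>_add: "\<Lambda> (m + n) = \<Lambda> m * \<Lambda> n"
proof (rule LIMSEQ_unique[OF p_tendsto])
  have "avg (\<lambda>i. real (L m (Y i))) \<longlonglongrightarrow> \<Lambda> m"
    using pair_mean[of "\<lambda>a b. real (L m a)"] by (simp add: \<Lambda>_def)
  from avg_p[OF this, of n] show "(\<lambda>J. real (p (m + n) J) / real J) \<longlonglongrightarrow> \<Lambda> m * \<Lambda> n"
    by (simp add: p_add p_sum[of m])
qed

lemma \<Lambda>_power: "\<Lambda> n = \<Lambda> 1 ^ n"
proof (induction n)
  case 0
  have "\<Lambda> 0 * \<Lambda> 0 = \<Lambda> 0" using \<Lambda>_add[of 0 0] by simp
  then show ?case using \<Lambda>_ge_1[of 0] by simp
next
  case (Suc n)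
  then show ?case using \<Lambda>_add[of 1 n] by simp
qed

definition letter_freq :: "nat \<Rightarrow> real" where
  "letter_freq c = pair_mean (\<lambda>a b. of_bool (a = c))"

lemma letter_freq: "avg (\<lambda>i. of_bool (Y i = c)) \<longlonglongrightarrow> letter_freq c"
  using pair_mean[of "\<lambda>a b. of_bool (a = c)"] by (simp add: letter_freq_def)

text \<open>Every block of order \<open>K\<close> contains \<open>c\<close>, so there is at least
  one occurrence per block and the frequency is at least \<open>1 / \<Lambda> K\<close>.\<close>

lemma letter_freq_pos:
  assumes "c < d" shows "0 < letter_freq c"
proof -
  have "1 \<le> letter_freq c * \<Lambda> K"
  proof (rule LIMSEQ_le_const[OF avg_p[OF letter_freq]])
    have "real J \<le> (\<Sum>i<p K J. of_bool (Y i = c))" for J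
    proof -
      have "1 \<le> (\<Sum>i=p K j..<p K (Suc j). of_bool (Y i = c) :: real)" for j
      proof -
        obtain i where i: "p K j \<le> i" "i < p K (Suc j)" "Y i = c" using block_contains[OF assms] by blast
        then have "of_bool (Y i = c) \<le> (\<Sum>i=p K j..<p K (Suc j). of_bool (Y i = c) :: real)"
          by (intro member_le_sum) auto
        then show ?thesis using i by simp
      qed
      then have "(\<Sum>j<J. 1) \<le> (\<Sum>j<J. (\<Sum>i=p K j..<p K (Suc j). of_bool (Y i = c) :: real))"
        by (intro sum_mono)
      then show ?thesis by (simp only: sum_blocks) simp
    qed
    then have "1 \<le> (\<Sum>i<p K J. of_bool (Y i = c)) / real J" if "J \<ge> 1" for J
      using that by (simp add: divide_simps del: sum_of_bool_eq)
    then show "\<exists>N. \<forall>J\<ge>N. 1 \<le> (\<Sum>i<p K J. of_bool (Y i = c)) / real J" by blast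
  qed
  then have "0 < letter_freq c * \<Lambda> K" by linarith
  then show ?thesis using \<Lambda>_ge_1[of K] by (simp add: zero_less_mult_iff)
qed

text \<open>Both sides are the mean number of letters \<open>c\<close> in a block of order 1:
  counted letter by letter of the uncut sequence on the left, by the frequency of \<open>c\<close>
  on the right.\<close>

lemma letter_freq_eigen:
  "(\<Sum>a<d. real (count_list (\<sigma> a) c) * letter_freq a) = letter_freq c * \<Lambda> 1"
proof (rule LIMSEQ_unique[OF _ avg_p[OF letter_freq]])
  have cnt: "(\<Sum>i=p 1 j..<p 1 (Suc j). of_bool (Y i = c)) = real (count_list (\<sigma> (Y j)) c)" for j
  proof -
    have "(\<Sum>i=p 1 j..<p 1 (Suc j). of_bool (Y i = c) :: real) = (\<Sum>r<L 1 (Y j). of_bool (T 1 [Y j] ! r = c))"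
      unfolding block_sum_shift using Y_block[of _ 1 j] by (intro sum.cong refl) (simp only: lessThan_iff)
    also have "\<dots> = real (card {r. r < length (\<sigma> (Y j)) \<and> \<sigma> (Y j) ! r = c})"
      by (simp add: L_def of_bool_def sum.If_cases Collect_conj_eq lessThan_def del: snth.simps)
    finally show ?thesis by (simp add: count_list_eq_length_filter length_filter_conv_card eq_commute[of c])
  qed
  have lin: "pair_mean (\<lambda>a b. real (count_list (\<sigma> a) c)) = (\<Sum>a<d. real (count_list (\<sigma> a) c) * letter_freq a)"
  proof -
    have "letter_freq a = (\<Sum>b<d. pair_freq a b)" if "a < d" for a
    proof -
      have "letter_freq a = (\<Sum>a'<d. if a' = a then (\<Sum>b<d. pair_freq a' b) else 0)"
        unfolding letter_freq_def pair_mean_def by (rule sum.cong) auto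
      then show ?thesis using that by simp
    qed
    then show ?thesis unfolding pair_mean_def by (simp add: sum_distrib_left)
  qed
  have "avg (\<lambda>i. real (count_list (\<sigma> (Y i)) c)) \<longlonglongrightarrow> (\<Sum>a<d. real (count_list (\<sigma> a) c) * letter_freq a)"
    using pair_mean[of "\<lambda>a b. real (count_list (\<sigma> a) c)"] unfolding lin .
  then show "(\<lambda>J. (\<Sum>i<p 1 J. of_bool (Y i = c)) / real J) \<longlonglongrightarrow> (\<Sum>a<d. real (count_list (\<sigma> a) c) * letter_freq a)"
    unfolding sum_blocks cnt avg_def[abs_def] .
qed

end

section \<open>Positive eigenvectors\<close>

text \<open>The vector \<open>f\<close> is itself an eigenvector, which gives one inequality. For
  the other, an arbitrary eigenvector is compared with \<open>f\<close> at an index where its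
  modulus relative to \<open>f\<close> is largest; the entries of \<open>A\<close> are
  nonnegative.\<close>

lemma spectral_radius_right:
  fixes A :: "nat mat" and f :: "nat \<Rightarrow> real"
  assumes A: "A \<in> carrier_mat d d" and d: "0 < d"
    and f: "\<And>i. i < d \<Longrightarrow> 0 < f i"
    and eig: "\<And>i. i < d \<Longrightarrow> (\<Sum>j<d. real (A $$ (i, j)) * f j) = \<theta> * f i"
  shows "spectral_radius (map_mat of_nat A) = \<theta>"
proof -
  define B :: "complex mat" where "B = map_mat of_nat A"
  have B: "B \<in> carrier_mat d d" using A by (simp add: B_def)
  have mult: "(B *\<^sub>v v) $ i = (\<Sum>j<d. of_nat (A $$ (i, j)) * v $ j)" if "i < d" "v \<in> carrier_vec d" for v i
    using A that by (auto simp: B_def scalar_prod_def lessThan_atLeast0 intro!: sum.cong)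
  have \<theta>: "0 \<le> \<theta>"
  proof -
    have "0 \<le> (\<Sum>j<d. real (A $$ (0, j)) * f j)" using f by (intro sum_nonneg) (auto simp: less_imp_le)
    then show ?thesis using eig[OF d] f[OF d] by (simp add: zero_le_mult_iff)
  qed
  have "eigenvector B (vec d (\<lambda>i. of_real (f i))) (of_real \<theta>)"
    unfolding eigenvector_def
  proof (intro conjI)
    show "vec d (\<lambda>i. complex_of_real (f i)) \<in> carrier_vec (dim_row B)" using B by simp
    have "vec d (\<lambda>i. complex_of_real (f i)) $ 0 \<noteq> 0" using f[OF d] d by simp
    then show "vec d (\<lambda>i. complex_of_real (f i)) \<noteq> 0\<^sub>v (dim_row B)" using B d by (metis carrier_matD(1) index_zero_vec(1))
    show "B *\<^sub>v vec d (\<lambda>i. complex_of_real (f i)) = complex_of_real \<theta> \<cdot>\<^sub>v vec d (\<lambda>i. complex_of_real (f i))"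
    proof (rule eq_vecI)
      fix i assume "i < dim_vec (complex_of_real \<theta> \<cdot>\<^sub>v vec d (\<lambda>i. complex_of_real (f i)))"
      then have i: "i < d" by simp
      have "(B *\<^sub>v vec d (\<lambda>i. complex_of_real (f i))) $ i = (\<Sum>j<d. complex_of_real (real (A $$ (i, j)) * f j))"
        using i by (simp add: mult)
      also have "\<dots> = complex_of_real (\<theta> * f i)" using eig[OF i] by (metis of_real_sum)
      finally show "(B *\<^sub>v vec d (\<lambda>i. complex_of_real (f i))) $ i
          = (complex_of_real \<theta> \<cdot>\<^sub>v vec d (\<lambda>i. complex_of_real (f i))) $ i" using i by simp
    qed (use B in simp)
  qed
  then have "of_real \<theta> \<in> spectrum B" by (auto simp: spectrum_def eigenvalue_def)
  then have "cmod (of_real \<theta>) \<in> cmod ` spectrum B" by blast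
  then have ge: "\<theta> \<le> spectral_radius B" using spectral_radius_mem_max(2)[OF B d] \<theta> by simp
  have "cmod l \<le> \<theta>" if "l \<in> spectrum B" for l
  proof -
    have "\<exists>z. z \<in> carrier_vec d \<and> z \<noteq> 0\<^sub>v d \<and> B *\<^sub>v z = l \<cdot>\<^sub>v z"
      using that unfolding spectrum_def eigenvalue_def eigenvector_def mem_Collect_eq carrier_matD(1)[OF B] .
    then obtain z where z: "z \<in> carrier_vec d" "z \<noteq> 0\<^sub>v d" "B *\<^sub>v z = l \<cdot>\<^sub>v z"
      by blast
    \<comment> \<open>The norm of \<open>z\<close> in the supremum norm weighted by
      \<open>f\<close>, in which the operator norm of \<open>A\<close> is \<theta>.\<close>
    define c where "c = Max ((\<lambda>i. cmod (z $ i) / f i) ` {..<d})"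
    have c_ge: "cmod (z $ i) \<le> c * f i" if "i < d" for i
    proof -
      have "cmod (z $ i) / f i \<le> c" unfolding c_def using that by (intro Max_ge) auto
      then show ?thesis using f[OF that] by (simp add: divide_simps)
    qed
    have "c \<in> (\<lambda>i. cmod (z $ i) / f i) ` {..<d}" unfolding c_def using d by (intro Max_in) auto
    then obtain i where i: "i < d" "c = cmod (z $ i) / f i" by auto
    have ci: "c * f i = cmod (z $ i)" using i f[OF i(1)] by simp
    have "\<exists>k<d. z $ k \<noteq> 0"
    proof (rule ccontr)
      assume "\<not> ?thesis"
      then have "z = 0\<^sub>v d" using z(1) by (intro eq_vecI) auto
      then show False using z(2) by simp
    qed
    then obtain k where k: "k < d" "0 < cmod (z $ k)" by auto
    then have "0 < c * f k" using c_ge[of k] by linarith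
    then have "0 < c" using f[OF k(1)] by (simp add: zero_less_mult_iff)
    then have zi: "0 < cmod (z $ i)" using mult_pos_pos[OF _ f[OF i(1)], of c] unfolding ci by blast
    have "cmod l * cmod (z $ i) = cmod ((B *\<^sub>v z) $ i)" using z i(1) by (simp add: norm_mult)
    also have "\<dots> = cmod (\<Sum>j<d. of_nat (A $$ (i, j)) * z $ j)" using mult[OF i(1) z(1)] by simp
    also have "\<dots> \<le> (\<Sum>j<d. real (A $$ (i, j)) * (c * f j))"
      using c_ge by (intro sum_norm_le) (auto simp: norm_mult intro!: mult_left_mono)
    also have "\<dots> = c * (\<theta> * f i)" 
      unfolding eig[OF i(1), symmetric] by (simp add: sum_distrib_left mult.left_commute)
    also have "\<dots> = \<theta> * cmod (z $ i)" unfolding ci[symmetric] by simp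
    finally show ?thesis using zi by simp
  qed
  then have "spectral_radius B \<le> \<theta>" using spectral_radius_mem_max(1)[OF B d] by auto
  with ge show ?thesis by (simp add: B_def)
qed

lemma spectral_radius_left:
  fixes A :: "nat mat" and f :: "nat \<Rightarrow> real"
  assumes A: "A \<in> carrier_mat d d" and d: "0 < d"
    and f: "\<And>i. i < d \<Longrightarrow> 0 < f i"
    and eig: "\<And>j. j < d \<Longrightarrow> (\<Sum>i<d. f i * real (A $$ (i, j))) = \<theta> * f j"
  shows "spectral_radius (map_mat of_nat A) = \<theta>"
proof -
  let ?B = "map_mat of_nat A :: complex mat"
  have B: "?B \<in> carrier_mat d d" using A by simp
  have "spectrum ?B\<^sup>T = spectrum ?B"
    using B spectrum_root_char_poly[OF B] spectrum_root_char_poly[of "?B\<^sup>T" d] char_poly_transpose_mat[OF B] by simp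
  moreover have "?B\<^sup>T = map_mat of_nat A\<^sup>T" by (simp add: map_mat_transpose)
  moreover have "spectral_radius (map_mat of_nat A\<^sup>T) = \<theta>"
  proof (rule spectral_radius_right[OF _ d f])
    fix i assume i: "i < d"
    have "(\<Sum>j<d. real (A\<^sup>T $$ (i, j)) * f j) = (\<Sum>j<d. f j * real (A $$ (j, i)))"
      using A i by (intro sum.cong) auto
    then show "(\<Sum>j<d. real (A\<^sup>T $$ (i, j)) * f j) = \<theta> * f i" using eig[OF i] by simp
  qed (use A in auto)
  ultimately show ?thesis by (simp add: spectral_radius_def)
qed

section \<open>Frequencies of prefixes\<close>

definition occurs :: "(nat \<Rightarrow> 'a) \<Rightarrow> nat \<Rightarrow> nat \<Rightarrow> bool" where
  "occurs X m i \<longleftrightarrow> (\<forall>t<m. X (i + t) = X t)"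

definition prefix_freq :: "(nat \<Rightarrow> 'a) \<Rightarrow> nat \<Rightarrow> real" where
  "prefix_freq X m = lim (avg (\<lambda>i. of_bool (occurs X m i)))"

definition has_period :: "(nat \<Rightarrow> 'a) \<Rightarrow> nat \<Rightarrow> bool" where
  "has_period X r \<longleftrightarrow> (\<forall>i. X (i + r) = X i)"

lemma avg_mono: "(\<And>i. f i \<le> g i) \<Longrightarrow> avg f N \<le> avg g N"
  unfolding avg_def by (intro divide_right_mono sum_mono) auto

lemma avg_shift:
  assumes "avg g \<longlonglongrightarrow> q"
  shows "avg (\<lambda>s. g (s + i)) \<longlonglongrightarrow> q"
proof -
  have "(\<lambda>N. avg g (N + i) * (1 + real i / real N) - (\<Sum>s<i. g s) / real N) \<longlonglongrightarrow> q * (1 + 0) - 0"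
    by (intro tendsto_intros LIMSEQ_ignore_initial_segment assms lim_const_over_n)
  moreover have "\<forall>\<^sub>F N in sequentially.
      avg g (N + i) * (1 + real i / real N) - (\<Sum>s<i. g s) / real N = avg (\<lambda>s. g (s + i)) N"
    using eventually_gt_at_top[of 0]
  proof eventually_elim
    case (elim N)
    have "(\<Sum>s<N + i. g s) = (\<Sum>s<i. g s) + (\<Sum>s=i..<N + i. g s)"
      unfolding lessThan_atLeast0 by (rule sum.atLeastLessThan_concat[symmetric]) auto
    also have "(\<Sum>s=i..<N + i. g s) = (\<Sum>s<N. g (s + i))"
      using sum.shift_bounds_nat_ivl[of g 0 i N] by (simp add: lessThan_atLeast0)
    finally have s: "(\<Sum>s<N. g (s + i)) = (\<Sum>s<N + i. g s) - (\<Sum>s<i. g s)" by simp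
    have "1 + real i / real N = real (N + i) / real N" using elim by (simp add: add_divide_distrib)
    then have "avg g (N + i) * (1 + real i / real N) = (\<Sum>s<N + i. g s) / real N"
      using elim by (simp add: avg_def)
    then show ?case unfolding avg_def[of "\<lambda>s. g (s + i)"] s by (simp add: diff_divide_distrib)
  qed
  ultimately show ?thesis by (simp add: Lim_transform_eventually)
qed

text \<open>If the frequency stabilises at length \<open>m0\<close>, the prefix of length \<open>m0\<close> has only one continuation,
  so any later occurrence of it is a period.\<close>
lemma infinite_prefix_freqs:
  fixes X :: "nat \<Rightarrow> 'a"
  assumes conv: "\<And>m. avg (\<lambda>i. of_bool (occurs X m i)) \<longlonglongrightarrow> prefix_freq X m"
    and pos: "\<And>m. 0 < prefix_freq X m"
    and recur: "\<And>m. \<exists>i>0. occurs X m i"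
    and aper: "\<And>r. r > 0 \<Longrightarrow> \<not> has_period X r"
  shows "infinite (range (prefix_freq X))"
proof
  assume fin: "finite (range (prefix_freq X))"
  have anti: "prefix_freq X m' \<le> prefix_freq X m" if "m \<le> m'" for m m'
  proof (rule LIMSEQ_le[OF conv conv])
    have "of_bool (occurs X m' i) \<le> (of_bool (occurs X m i) :: real)" for i
      using that by (simp add: occurs_def)
    then have "avg (\<lambda>i. of_bool (occurs X m' i)) N \<le> avg (\<lambda>i. of_bool (occurs X m i)) N" for N
      by (rule avg_mono)
    then show "\<exists>N. \<forall>n\<ge>N. avg (\<lambda>i. of_bool (occurs X m' i)) n \<le> avg (\<lambda>i. of_bool (occurs X m i)) n"
      by blast
  qed
  have "Min (range (prefix_freq X)) \<in> range (prefix_freq X)" using fin by (rule Min_in) simp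
  then obtain m0 where "prefix_freq X m0 = Min (range (prefix_freq X))" by (metis imageE)
  then have m0: "prefix_freq X m0 \<le> prefix_freq X m" for m
    using Min_le[OF fin, of "prefix_freq X m"] by simp
  obtain i where i: "i > 0" "occurs X m0 i" using recur by blast
  have "X (i + t) = X t" for t
  proof (rule ccontr)
    assume bad: "X (i + t) \<noteq> X t"
    define m where "m = (LEAST t. X (i + t) \<noteq> X t)"
    have m: "X (i + m) \<noteq> X m" unfolding m_def by (rule LeastI, rule bad)
    have occ: "occurs X m i" unfolding occurs_def m_def using not_less_Least by blast
    have "m0 \<le> m" using m i by (auto simp: occurs_def not_less[symmetric])
    \<comment> \<open>An occurrence of the prefix of length \<open>M\<close> at \<open>s\<close>
      shows at \<open>s + i\<close> the prefix of length \<open>m\<close> followed by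
      \<open>X (i + m)\<close>, which differs from \<open>X m\<close>. So it competes with the
      occurrences of the prefix of length \<open>Suc m\<close>, and takes a positive share of the
      frequency at length \<open>m\<close>.\<close>
    define M where "M = i + m + 1"
    have "of_bool (occurs X M s) + of_bool (occurs X (Suc m) (s + i)) \<le> (of_bool (occurs X m (s + i)) :: real)" for s
    proof (cases "occurs X M s")
      case True
      then have M: "X (s + (i + t)) = X (i + t)" if "t \<le> m" for t
        using that by (simp add: occurs_def M_def)
      have "occurs X m (s + i)" using M occ by (simp add: occurs_def add.assoc)
      moreover have "\<not> occurs X (Suc m) (s + i)"
        using M[of m] m by (auto simp: occurs_def add.assoc intro!: exI[of _ m])
      ultimately show ?thesis by simp
    next
      case False
      then show ?thesis by (auto simp: occurs_def)
    qed
    then have "avg (\<lambda>s. of_bool (occurs X M s) + of_bool (occurs X (Suc m) (s + i))) N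
        \<le> avg (\<lambda>s. of_bool (occurs X m (s + i))) N" for N
      by (rule avg_mono)
    then have "avg (\<lambda>s. of_bool (occurs X M s)) N + avg (\<lambda>s. of_bool (occurs X (Suc m) (s + i))) N
        \<le> avg (\<lambda>s. of_bool (occurs X m (s + i))) N" for N
      by (simp add: avg_def sum.distrib add_divide_distrib del: sum_of_bool_eq)
    then have "prefix_freq X M + prefix_freq X (Suc m) \<le> prefix_freq X m"
      by (intro LIMSEQ_le[OF tendsto_add[OF conv avg_shift[OF conv]] avg_shift[OF conv]]) blast
    moreover have "prefix_freq X m \<le> prefix_freq X (Suc m)"
      using anti[OF \<open>m0 \<le> m\<close>] m0[of "Suc m"] by linarith
    ultimately show False using pos[of M] by linarith
  qed
  then have "has_period X i" by (simp add: has_period_def add.commute)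
  then show False using aper i by blast
qed

section \<open>Linear recurrence and the values of prefix frequencies\<close>

context primitive_fixed_point
begin

lemma dominant_eigenvalue: "dominant_eigenvalue d \<sigma> = \<Lambda> 1"
  unfolding dominant_eigenvalue_def
proof (rule spectral_radius_right[OF _ d_pos letter_freq_pos])
  show "subst_mat d \<sigma> \<in> carrier_mat d d" by (simp add: subst_mat_def)
  fix c assume "c < d"
  then show "(\<Sum>a<d. real (subst_mat d \<sigma> $$ (c, a)) * letter_freq a) = \<Lambda> 1 * letter_freq c"
    using letter_freq_eigen[of c] by (simp add: subst_mat_def mult.commute)
qed

lemma W_pos: "0 < W"
  using L_pos[of 0 1] by (auto simp: W_def intro!: sum_pos2[of _ 0])

text \<open>At the least order where all blocks reach length \<open>l\<close>, the previous order
  still has a block shorter than \<open>l\<close>. Comparison within an order costs the factor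
  \<open>V\<close>, the step to the next order the factor \<open>W\<close>.\<close>

lemma scale:
  assumes "0 < l"
  shows "\<exists>n. (\<forall>a<d. l \<le> L n a) \<and> (\<forall>a<d. L n a \<le> W * V * l)"
proof -
  define n where "n = (LEAST n. \<forall>a<d. l \<le> L n a)"
  have "\<exists>n. \<forall>a<d. l \<le> L n a" using L_unbounded by blast
  then have n: "\<forall>a<d. l \<le> L n a" unfolding n_def by (rule LeastI_ex)
  have "L n a \<le> W * V * l" if a: "a < d" for a
  proof (cases n)
    case 0
    then show ?thesis using assms W_pos V_pos by (simp add: L_def Suc_le_eq)
  next
    case (Suc n')
    then have "\<not> (\<forall>a<d. l \<le> L n' a)" using not_less_Least[of n' "\<lambda>n. \<forall>a<d. l \<le> L n a"] unfolding n_def by simp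
    then obtain c where c: "c < d" "L n' c < l" by (auto simp: not_le)
    have "L n a \<le> W * L n' a" unfolding Suc using a by (rule L_Suc_le)
    also have "\<dots> \<le> W * (V * L n' c)" using L_compare a c by simp
    also have "\<dots> \<le> W * (V * l)" using c by simp
    finally show ?thesis by (simp add: mult.assoc)
  qed
  then show ?thesis using n by blast
qed

lemma early_pairs: "\<exists>P. \<forall>j. \<exists>j'<P. Y j' = Y j \<and> Y (Suc j') = Y (Suc j)"
proof -
  let ?f = "\<lambda>j. (Y j, Y (Suc j))"
  have "range ?f \<subseteq> {..<d} \<times> {..<d}" by auto
  then have "finite (range ?f)" by (rule finite_subset) auto
  from finite_subset_image[OF this subset_refl]
  obtain S where S: "finite S" "range ?f = ?f ` S" by blast
  then obtain P where "S \<subseteq> {..<P}" using finite_nat_iff_bounded by blast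
  moreover have "\<exists>j'\<in>S. Y j' = Y j \<and> Y (Suc j') = Y (Suc j)" for j
  proof -
    have "?f j \<in> ?f ` S" using S(2) by blast
    then show ?thesis by force
  qed
  ultimately show ?thesis by (meson lessThan_iff subsetD)
qed

end

locale coded_fixed_point = primitive_fixed_point d \<sigma> y for d \<sigma> y +
  fixes \<phi> :: "nat \<Rightarrow> 'a"
begin

definition X :: "nat \<Rightarrow> 'a" where "X i = \<phi> (Y i)"

lemma prefix_freq: "avg (\<lambda>i. of_bool (occurs X m i)) \<longlonglongrightarrow> prefix_freq X m"
proof -
  have "\<exists>q. avg (\<lambda>i. of_bool (occurs X m i)) \<longlonglongrightarrow> q"
    by (rule window_mean_exists[where m = m]) (auto simp: occurs_def X_def)
  then show ?thesis unfolding prefix_freq_def by (auto simp: limI)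
qed

text \<open>Every block of type \<open>Y 0\<close> of sufficiently high order begins with the
  prefix, and every block of order \<open>n + K\<close> contains one of these. The block after the
  one containing \<open>N\<close> is used, so that the occurrence lies beyond
  \<open>N\<close>.\<close>

lemma syndetic: "\<exists>R>0. \<forall>N. \<exists>i. N < i \<and> i \<le> N + R \<and> occurs X m i"
proof -
  obtain n where n: "\<And>a. a < d \<Longrightarrow> m \<le> L n a" using L_unbounded by meson
  define C where "C = (\<Sum>a<d. L (n + K) a)"
  have LC: "L (n + K) (Y j) \<le> C" for j unfolding C_def by (intro member_le_sum) auto
  have "\<exists>i. N < i \<and> i \<le> N + 2 * C \<and> occurs X m i" for N
  proof -
    obtain j where j: "p (n + K) j \<le> N" "N < p (n + K) (Suc j)" using block_of by blast
    obtain t where t: "p K (Suc j) \<le> t" "t < p K (Suc (Suc j))" "Y t = Y 0"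
      using block_contains[of "Y 0" "Suc j"] by auto
    have "occurs X m (p n t)" unfolding occurs_def X_def
    proof (intro allI impI)
      fix s assume "s < m"
      then have "s < L n (Y t)" using n[of "Y t"] by simp
      then show "\<phi> (Y (p n t + s)) = \<phi> (Y s)" using block_eq[OF t(3)] by simp
    qed
    moreover have "p (n + K) (Suc j) \<le> p n t" unfolding p_add using t by (intro p_mono)
    moreover have "p n t \<le> p (n + K) (Suc (Suc j))" unfolding p_add using t by (intro p_mono) simp
    moreover have "p (n + K) (Suc (Suc j)) \<le> N + 2 * C"
      using j(1) LC[of j] LC[of "Suc j"] by simp
    ultimately show ?thesis using j(2) by (intro exI[of _ "p n t"]) linarith
  qed
  moreover have "2 * C > 0" using LC[of 0] L_pos[OF Y_less[of 0], of "n + K"] by linarith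
  ultimately show ?thesis by blast
qed

lemma prefix_freq_pos: "0 < prefix_freq X m"
proof -
  obtain R where R: "R > 0" "\<And>N. \<exists>i. N < i \<and> i \<le> N + R \<and> occurs X m i" using syndetic by blast
  \<comment> \<open>The shift by one turns the intervals N < i <= N + R supplied by
    \<open>syndetic\<close> into half-open intervals that tile the positions.\<close>
  define g where "g i = (of_bool (occurs X m (i + 1)) :: real)" for i
  have g: "avg g \<longlonglongrightarrow> prefix_freq X m" unfolding g_def by (rule avg_shift[OF prefix_freq])
  have "real J \<le> (\<Sum>i<R * J. g i)" for J
  proof (induction J)
    case (Suc J)
    obtain i where i: "R * J < i" "i \<le> R * J + R" "occurs X m i" using R(2) by blast
    then have "g (i - 1) = 1" by (simp add: g_def)
    moreover have "g (i - 1) \<le> (\<Sum>i=R * J..<R * Suc J. g i)"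
      using i by (intro member_le_sum) (auto simp: g_def)
    moreover have "(\<Sum>i<R * Suc J. g i) = (\<Sum>i<R * J. g i) + (\<Sum>i=R * J..<R * Suc J. g i)"
      unfolding lessThan_atLeast0 by (rule sum.atLeastLessThan_concat[symmetric]) auto
    ultimately show ?case using Suc by linarith
  qed simp
  then have "1 / real R \<le> avg g (R * J)" if "J \<ge> 1" for J
    using that R(1) unfolding avg_def by (simp add: field_simps)
  moreover have "filterlim (\<lambda>J. R * J) at_top sequentially"
    using R(1) by (intro filterlim_subseq) (simp add: strict_mono_def)
  then have "(\<lambda>J. avg g (R * J)) \<longlonglongrightarrow> prefix_freq X m" by (rule filterlim_compose[OF g])
  ultimately have "1 / real R \<le> prefix_freq X m" by (intro LIMSEQ_le_const) auto
  then show ?thesis using R(1) by (smt (verit) divide_pos_pos of_nat_0_less_iff)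
qed

text \<open>At the order where blocks have length comparable to \<open>l\<close>, each factor of
  length \<open>l\<close> lies in two consecutive blocks. Their pair of letters already appears
  among the first \<open>P\<close> pairs, so the factor appears after at most \<open>P\<close>
  blocks and an offset inside one more.\<close>

lemma linearly_recurrent:
  "\<exists>C>0. \<forall>l>0. \<forall>i. \<exists>i'. i' + l \<le> C * l \<and> (\<forall>t<l. X (i' + t) = X (i + t))"
proof -
  obtain P where P: "\<And>j. \<exists>j'<P. Y j' = Y j \<and> Y (Suc j') = Y (Suc j)" using early_pairs by blast
  have "\<exists>i'. i' + l \<le> (P + 2) * (W * V) * l \<and> (\<forall>t<l. X (i' + t) = X (i + t))" if l: "l > 0" for l i
  proof -
    obtain n where n: "\<And>a. a < d \<Longrightarrow> l \<le> L n a" "\<And>a. a < d \<Longrightarrow> L n a \<le> W * V * l"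
      using scale[OF l] by blast
    obtain j where j: "p n j \<le> i" "i < p n (Suc j)" using block_of by blast
    define r where "r = i - p n j"
    have i: "i = p n j + r" and r: "r < L n (Y j)" using j by (auto simp: r_def)
    obtain j' where j': "j' < P" "Y j' = Y j" "Y (Suc j') = Y (Suc j)" using P by blast
    have "X (p n j' + r + t) = X (i + t)" if "t < l" for t
    proof -
      have "p n j' + (r + t) < p n (Suc (Suc j'))"
        using that r n(1)[of "Y (Suc j)"] j' by simp
      from two_blocks_eq[OF j'(2,3) this] show ?thesis by (simp add: X_def i add.assoc)
    qed
    moreover have "p n j' + r + l \<le> (P + 2) * (W * V) * l"
    proof -
      have "p n j' \<le> (\<Sum>t<j'. W * V * l)" unfolding p_sum using n(2) by (intro sum_mono) simp
      also have "\<dots> \<le> P * (W * V * l)" using j'(1) by simp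
      finally have "p n j' \<le> P * (W * V * l)" .
      moreover have "r \<le> W * V * l" using r n(2)[of "Y j"] by simp
      moreover have "l \<le> W * V * l" by (rule order.trans[OF n(1)[OF d_pos] n(2)[OF d_pos]])
      ultimately have "p n j' + r + l \<le> P * (W * V * l) + W * V * l + W * V * l" by linarith
      then show ?thesis by (simp add: algebra_simps)
    qed
    ultimately show ?thesis by blast
  qed
  moreover have "(P + 2) * (W * V) > 0" using W_pos V_pos by simp
  ultimately show ?thesis by blast
qed

text \<open>Overlapping the two occurrences gives the prefix of length \<open>m\<close> the local
  period \<open>r\<close>. Any factor of length \<open>r + 1\<close> has a copy inside this prefix,
  and there its first and last letters agree.\<close>

lemma short_return_periodic:
  assumes C: "\<And>l i. l > 0 \<Longrightarrow> \<exists>i'. i' + l \<le> C * l \<and> (\<forall>t<l. X (i' + t) = X (i + t))"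
    and m: "C * (r + 1) \<le> m" and occ: "occurs X m i" "occurs X m (i + r)"
  shows "has_period X r"
  unfolding has_period_def
proof
  fix s
  have per: "X (t + r) = X t" if "t + r < m" for t
  proof -
    have "X (i + (t + r)) = X (t + r)" using occ(1) that by (simp add: occurs_def)
    moreover have "X (i + r + t) = X t" using occ(2) that by (simp add: occurs_def)
    ultimately show ?thesis by (simp add: ac_simps)
  qed
  obtain i' where i': "i' + (r + 1) \<le> C * (r + 1)" "\<And>t. t < r + 1 \<Longrightarrow> X (i' + t) = X (s + t)"
    using C[of "r + 1" s] by auto
  have "X (i' + r) = X i'" using i'(1) m by (intro per) linarith
  then show "X (s + r) = X s" using i'(2)[of 0] i'(2)[of r] by simp
qed

lemma finite_prefix_freqs:
  assumes aper: "\<And>r. r > 0 \<Longrightarrow> \<not> has_period X r"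
  shows "\<exists>F. finite F \<and> (\<forall>m>0. \<exists>n. prefix_freq X m * \<Lambda> 1 ^ n \<in> F)"
proof -
  obtain C where C: "C > 0" "\<And>l i. l > 0 \<Longrightarrow> \<exists>i'. i' + l \<le> C * l \<and> (\<forall>t<l. X (i' + t) = X (i + t))"
    using linearly_recurrent by blast
  \<comment> \<open>Two occurrences are at least m / (2 C) apart, and a block has length at most
    \<open>W * V * m\<close>; the quotient is \<open>B\<close>.\<close>
  define B where "B = 2 * C * (W * V)"
  let ?val = "\<lambda>k. \<Sum>a<d. \<Sum>b<d. real (k (a, b)) * pair_freq a b"
  let ?F = "?val ` (({..<d} \<times> {..<d}) \<rightarrow>\<^sub>E {..B})"
  have "\<exists>n. prefix_freq X m * \<Lambda> 1 ^ n \<in> ?F" if m: "m > 0" for m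
  proof -
    obtain n where n: "\<And>a. a < d \<Longrightarrow> m \<le> L n a" "\<And>a. a < d \<Longrightarrow> L n a \<le> W * V * m"
      using scale[OF m] by blast
    define c where "c j = card {r. r < L n (Y j) \<and> occurs X m (p n j + r)}" for j
    have c_le: "c j \<le> B" for j
    proof -
      let ?S = "{r. r < L n (Y j) \<and> occurs X m (p n j + r)}"
      \<comment> \<open>Buckets of width m / (2 C): distinct occurrences fall into distinct buckets,
        and the block meets at most \<open>B\<close> of them.\<close>
      let ?h = "\<lambda>r. (2 * C * r) div m"
      have lt: "?h r < ?h r'" if "r \<in> ?S" "r' \<in> ?S" "r < r'" for r r'
      proof -
        have "\<not> C * ((r' - r) + 1) \<le> m"
          using short_return_periodic[OF C(2), of "r' - r" m "p n j + r"] aper[of "r' - r"] that by auto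
        moreover have "C * ((r' - r) + 1) \<le> C * (2 * (r' - r))" using that(3) by (intro mult_le_mono2) simp
        ultimately have "m \<le> C * (2 * (r' - r))" by linarith
        then have "2 * C * r + m \<le> 2 * C * r + 2 * C * (r' - r)" by (simp add: mult_ac)
        also have "\<dots> = 2 * C * r'" using that(3) by (simp flip: distrib_left)
        finally have "(2 * C * r + m) div m \<le> ?h r'" by (rule div_le_mono)
        then show ?thesis using m by simp
      qed
      have "inj_on ?h ?S"
      proof (rule inj_onI)
        fix r r' assume "r \<in> ?S" "r' \<in> ?S" "?h r = ?h r'"
        then show "r = r'" using lt[of r r'] lt[of r' r] by (metis less_irrefl linorder_neqE_nat)
      qed
      moreover have "?h ` ?S \<subseteq> {..<B}"
      proof
        fix z assume "z \<in> ?h ` ?S"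
        then obtain r where r: "r < L n (Y j)" "z = ?h r" by blast
        have "r < W * V * m" using r(1) n(2)[of "Y j"] by simp
        then have "2 * C * r < B * m" using C(1) by (simp add: B_def mult.assoc)
        then show "z \<in> {..<B}" unfolding r(2) by (simp add: less_mult_imp_div_less)
      qed
      ultimately have "card ?S \<le> card {..<B}" by (intro card_inj_on_le) auto
      then show ?thesis by (simp add: c_def)
    qed
    have c_eq: "c j = c j'" if "Y j = Y j'" "Y (Suc j) = Y (Suc j')" for j j'
    proof -
      have "X (p n j + r + t) = X (p n j' + r + t)" if "r < L n (Y j)" "t < m" for r t
      proof -
        have "p n j + (r + t) < p n (Suc (Suc j))" using that n(1)[of "Y (Suc j)"] by simp
        from two_blocks_eq[OF \<open>Y j = Y j'\<close> \<open>Y (Suc j) = Y (Suc j')\<close> this]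
        show ?thesis by (simp add: X_def add.assoc)
      qed
      then have "{r. r < L n (Y j) \<and> occurs X m (p n j + r)} = {r. r < L n (Y j') \<and> occurs X m (p n j' + r)}"
        using that(1) by (auto simp: occurs_def)
      then show ?thesis by (simp add: c_def)
    qed
    \<comment> \<open>By \<open>c_eq\<close> the count depends only on the pair, so any index with
      this pair serves as representative. Pairs that never occur get 0, which keeps \<open>k\<close>
      within the bound \<open>B\<close>.\<close>
    define k where "k a b = (if \<exists>j. Y j = a \<and> Y (Suc j) = b then c (SOME j. Y j = a \<and> Y (Suc j) = b) else 0)" for a b
    have k: "c j = k (Y j) (Y (Suc j))" for j
    proof -
      have "Y (SOME j'. Y j' = Y j \<and> Y (Suc j') = Y (Suc j)) = Y j \<and>
          Y (Suc (SOME j'. Y j' = Y j \<and> Y (Suc j') = Y (Suc j))) = Y (Suc j)"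
        by (rule someI[of _ j]) simp
      then show ?thesis using c_eq unfolding k_def by (metis (no_types, lifting))
    qed
    have blk: "(\<Sum>i=p n j..<p n (Suc j). of_bool (occurs X m i)) = real (k (Y j) (Y (Suc j)))" for j
      unfolding block_sum_shift k[symmetric] c_def
      by (simp add: of_bool_def sum.If_cases Collect_conj_eq lessThan_def)
    have "(\<lambda>J. (\<Sum>i<p n J. of_bool (occurs X m i)) / real J) \<longlonglongrightarrow> prefix_freq X m * \<Lambda> n"
      by (rule avg_p[OF prefix_freq])
    then have "avg (\<lambda>j. real (k (Y j) (Y (Suc j)))) \<longlonglongrightarrow> prefix_freq X m * \<Lambda> n"
      unfolding sum_blocks blk avg_def[abs_def] .
    then have "prefix_freq X m * \<Lambda> n = pair_mean (\<lambda>a b. real (k a b))"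
      using pair_mean by (rule LIMSEQ_unique)
    also have "\<dots> = ?val (restrict (\<lambda>(a, b). k a b) ({..<d} \<times> {..<d}))"
      unfolding pair_mean_def by (intro sum.cong) auto
    also have "\<dots> \<in> ?F" using c_le by (intro imageI PiE_I) (auto simp: k_def)
    finally show ?thesis unfolding \<Lambda>_power[of n] by blast
  qed
  moreover have "finite ?F" by (intro finite_imageI finite_PiE) auto
  ultimately show ?thesis by blast
qed

lemma infinite_freqs:
  assumes "\<And>r. r > 0 \<Longrightarrow> \<not> has_period X r"
  shows "infinite (range (prefix_freq X))"
  using assms syndetic
  by (intro infinite_prefix_freqs prefix_freq prefix_freq_pos) (auto, metis add_0)

end

section \<open>From prefix frequencies to periodicity\<close>

lemma shift_self_unique:
  assumes "s = v @- s" "s' = v @- s'" "v \<noteq> []"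
  shows "s = s'"
proof -
  have "s !! n = s' !! n" for n
  proof (induction n rule: less_induct)
    case (less n)
    show ?case
    proof (cases "n < length v")
      case True
      have "s !! n = (v @- s) !! n" "s' !! n = (v @- s') !! n" using assms by simp_all
      then show ?thesis using True by simp
    next
      case False
      have "s !! n = (v @- s) !! n" "s' !! n = (v @- s') !! n" using assms by simp_all
      moreover have "n - length v < n" using False assms(3) by (cases v) auto
      ultimately show ?thesis using less False by simp
    qed
  qed
  then show ?thesis using smap_alt[of "\<lambda>x. x" s s'] by (simp add: stream.map_ident)
qed

lemma has_period_imp_cycle:
  assumes "has_period (snth x) r" "r > 0"
  shows "x = cycle (stake r x)"
proof (rule shift_self_unique)
  have "sdrop r x = x"
    using assms(1) smap_alt[of "\<lambda>x. x" "sdrop r x" x]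
    by (simp add: has_period_def sdrop_snth add.commute stream.map_ident)
  then show "x = stake r x @- x" by (metis stake_sdrop)
  show v: "stake r x \<noteq> []" using assms(2) by simp
  show "cycle (stake r x) = stake r x @- cycle (stake r x)" using v by (rule cycle_decomp)
qed

text \<open>The smaller of the two values needs the larger exponent to reach the common value, which
  makes the exponent of the quotient positive.\<close>

lemma common_ratio_powers:
  fixes \<alpha> v w :: real
  assumes "v * \<alpha> ^ n = w * \<alpha> ^ k" "0 < v" "v < w" "\<alpha> > 1"
  shows "\<exists>e>0. w / v = \<alpha> ^ e"
proof -
  have "k < n"
  proof (rule ccontr)
    assume "\<not> k < n"
    then have "\<alpha> ^ n \<le> \<alpha> ^ k" using assms(4) by (intro power_increasing) auto
    then have "v * \<alpha> ^ n < w * \<alpha> ^ k" using assms by (intro mult_less_le_imp_less) auto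
    then show False using assms(1) by simp
  qed
  moreover have "w / v = \<alpha> ^ (n - k)"
    using assms calculation by (simp add: power_diff field_simps)
  ultimately show ?thesis by (intro exI[of _ "n - k"]) simp
qed

theorem cobham_primitive:
  assumes "substitutive_primitive \<alpha> x" "substitutive_primitive \<beta> x"
    and "\<alpha> > 1" "\<beta> > 1" "mult_independent \<alpha> \<beta>"
  shows "periodic x"
proof (rule ccontr)
  assume "\<not> periodic x"
  then have aper: "\<not> has_period (snth x) r" if "r > 0" for r
    using has_period_imp_cycle[of x r] that unfolding periodic_def by (metis list.size(3) length_stake less_irrefl)
  have one: "\<exists>F. finite F \<and> (\<forall>m>0. \<exists>n. prefix_freq (snth x) m * \<theta> ^ n \<in> F)"
    "infinite (range (prefix_freq (snth x)))" "\<And>m. 0 < prefix_freq (snth x) m"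
    if \<theta>: "substitutive_primitive \<theta> x" for \<theta>
  proof -
    obtain d \<sigma> y \<phi> where s: "primitive_subst d \<sigma>" "dominant_eigenvalue d \<sigma> = \<theta>"
      "y \<in> streams {..<d}" "morph_seq \<sigma> y = y" "x = smap \<phi> y"
      using \<theta> unfolding substitutive_primitive_def by blast
    interpret coded_fixed_point d \<sigma> y \<phi> by unfold_locales (use s in auto)
    have X: "snth x = X" by (simp add: s(5) X_def fun_eq_iff)
    show "\<exists>F. finite F \<and> (\<forall>m>0. \<exists>n. prefix_freq (snth x) m * \<theta> ^ n \<in> F)"
      using finite_prefix_freqs aper unfolding X s(2)[symmetric] dominant_eigenvalue by blast
    show "infinite (range (prefix_freq (snth x)))" using infinite_freqs aper unfolding X by blast
    show "\<And>m. 0 < prefix_freq (snth x) m" unfolding X by (rule prefix_freq_pos)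
  qed
  let ?q = "prefix_freq (snth x)"
  obtain F where F: "finite F" "\<And>m. m > 0 \<Longrightarrow> \<exists>n. ?q m * \<alpha> ^ n \<in> F" using one(1)[OF assms(1)] by blast
  obtain G where G: "finite G" "\<And>m. m > 0 \<Longrightarrow> \<exists>n. ?q m * \<beta> ^ n \<in> G" using one(1)[OF assms(2)] by blast
  \<comment> \<open>Length 0 is excluded because the finiteness statements concern positive lengths;
    this removes at most one value.\<close>
  let ?Q = "?q ` {0<..}"
  have "(UNIV :: nat set) = insert 0 {0<..}" by auto
  then have "range ?q = insert (?q 0) ?Q" by (metis image_insert)
  then have infQ: "infinite ?Q" using one(2)[OF assms(1)] by simp
  have "\<forall>v\<in>?Q. \<exists>n k. v * \<alpha> ^ n \<in> F \<and> v * \<beta> ^ k \<in> G" using F(2) G(2) by blast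
  then obtain n k where nk: "\<And>v. v \<in> ?Q \<Longrightarrow> v * \<alpha> ^ n v \<in> F \<and> v * \<beta> ^ k v \<in> G" by metis
  \<comment> \<open>Pigeonhole on pairs: infinitely many frequencies but finitely many pairs, so one
    pair \<open>v\<close>, \<open>w\<close> is in a common progression for both ratios at
    once.\<close>
  let ?h = "\<lambda>v. (v * \<alpha> ^ n v, v * \<beta> ^ k v)"
  have "?h ` ?Q \<subseteq> F \<times> G" using nk by blast
  then have "finite (?h ` ?Q)" using F(1) G(1) by (meson finite_SigmaI finite_subset)
  then have "\<not> inj_on ?h ?Q" using infQ finite_imageD by blast
  then obtain v w where vw: "v \<in> ?Q" "w \<in> ?Q" "v < w" "?h v = ?h w"
    unfolding inj_on_def by (metis linorder_neqE_linordered_idom)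
  have v: "0 < v" using vw(1) one(3)[OF assms(1)] by auto
  obtain a where a: "a > 0" "w / v = \<alpha> ^ a"
    using common_ratio_powers[of v \<alpha> "n v" w "n w"] vw v assms(3) by auto
  obtain b where b: "b > 0" "w / v = \<beta> ^ b"
    using common_ratio_powers[of v \<beta> "k v" w "k w"] vw v assms(4) by auto
  have "\<alpha> ^ a = \<beta> ^ b" using a(2) b(2) by simp
  then show False using a(1) b(1) assms(5) unfolding mult_independent_def by blast
qed

section \<open>Powers of a Perron number\<close>

text \<open>Least degree gives irreducibility, hence access to the conjugates, and also simplicity
  of the root. Integrality of the coefficients comes from Gauss's lemma, applied to a monic integer
  polynomial that vanishes at \<alpha>.\<close>

lemma perron_integer_poly:
  assumes "perron_number \<alpha>" "\<alpha> > 1"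
  obtains f :: "int poly" and g :: "complex poly" where
    "lead_coeff f = 1" "of_int_poly f = [:- of_real \<alpha>, 1:] * g" "poly g (of_real \<alpha>) \<noteq> 0"
    "\<And>z. poly g z = 0 \<Longrightarrow> cmod z < \<alpha>"
proof -
  let ?a = "complex_of_real \<alpha>"
  let ?C = "map_poly of_rat :: rat poly \<Rightarrow> complex poly"
  interpret C: map_poly_inj_idom_hom "of_rat :: rat \<Rightarrow> complex" ..
  define root where "root p \<longleftrightarrow> p \<noteq> 0 \<and> poly (?C p) ?a = 0" for p
  have "algebraic_int ?a" using assms(1) by (simp add: perron_number_def algebraic_int_of_real)
  then obtain P :: "int poly" where P: "poly (of_int_poly P) ?a = 0" "lead_coeff P = 1"
    by (auto simp: algebraic_int_altdef_ipoly)
  have CP: "?C (of_int_poly P) = of_int_poly P" for P :: "int poly" by (simp add: map_poly_map_poly o_def)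
  have "P \<noteq> 0" using P(2) by auto
  then have "root (of_int_poly P)" using P(1) CP by (simp add: root_def)
  then obtain f0 where f0: "root f0" "\<And>p. root p \<Longrightarrow> degree f0 \<le> degree p"
    using ex_has_least_nat[of root _ degree] by blast
  define f1 where "f1 = smult (inverse (lead_coeff f0)) f0"
  have f1: "lead_coeff f1 = 1" "root f1" and deg: "degree f1 = degree f0"
    using f0(1) by (auto simp: f1_def root_def hom_distribs)
  have min: "degree f1 \<le> degree p" if "root p" for p using f0(2)[OF that] deg by simp
  have f1_dvd: "f1 dvd p" if "poly (?C p) ?a = 0" for p
  proof -
    have "?C p = ?C (p div f1) * ?C f1 + ?C (p mod f1)"
      by (metis C.hom_add C.hom_mult div_mult_mod_eq)
    then have "poly (?C (p mod f1)) ?a = 0" using that f1(2) by (simp add: root_def)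
    then have "p mod f1 = 0" using min[of "p mod f1"] f1(2) degree_mod_less'[of f1 p]
      by (auto simp: root_def not_le[symmetric])
    then show ?thesis by blast
  qed
  have "degree f1 > 0"
  proof (rule ccontr)
    assume "\<not> degree f1 > 0"
    then have "f1 = 1" using f1(1) by (metis degree_eq_zeroE gr0I lead_coeff_pCons(2) one_pCons)
    then show False using f1(2) by (simp add: root_def)
  qed
  have irr: "irreducible f1"
  proof (rule irreducibleI)
    show "f1 \<noteq> 0" using f1(2) by (simp add: root_def)
    show "\<not> is_unit f1" using \<open>degree f1 > 0\<close> by (auto simp: is_unit_iff_degree)
    fix b c assume bc: "f1 = b * c"
    have ne: "b \<noteq> 0" "c \<noteq> 0" using bc f1(2) by (auto simp: root_def)
    have d: "degree f1 = degree b + degree c" using bc ne by (simp add: degree_mult_eq)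
    have "poly (?C b) ?a = 0 \<or> poly (?C c) ?a = 0" using f1(2) bc by (simp add: root_def C.hom_mult)
    then show "is_unit b \<or> is_unit c"
      using min[of b] min[of c] ne d by (auto simp: root_def is_unit_iff_degree)
  qed
  \<comment> \<open>The factorisation of \<open>P\<close> descends to the integers. Since
    \<open>P\<close> is monic, the leading coefficient of the primitive factor \<open>rg\<close> is
    a unit, and its sign is positive.\<close>
  obtain h where h: "of_int_poly P = f1 * h"
    using f1_dvd[of "of_int_poly P"] P(1) CP by (auto elim: dvdE)
  obtain r rg where rg: "rat_to_normalized_int_poly f1 = (r, rg)" by force
  obtain t where t: "P = rg * t" using rat_to_int_factor_explicit[OF h rg] by blast
  have r: "f1 = smult r (of_int_poly rg)" "r > 0" using rat_to_normalized_int_poly[OF rg] by auto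
  have "lead_coeff rg * lead_coeff t = 1" using t P(2) by (simp add: lead_coeff_mult)
  moreover have lr: "1 = r * of_int (lead_coeff rg)" using f1(1) r by simp
  then have "0 < r * rat_of_int (lead_coeff rg)" by simp
  from zero_less_mult_pos[OF this r(2)] have "lead_coeff rg > 0" by simp
  ultimately have lead: "lead_coeff rg = 1" by (metis pos_zmult_eq_1_iff)
  then have f1_rg: "f1 = of_int_poly rg" using r lr by simp
  have "poly (?C f1) ?a = 0" using f1(2) by (simp add: root_def)
  then obtain g where g: "?C f1 = [:- ?a, 1:] * g" by (auto simp: poly_eq_0_iff_dvd elim: dvdE)
  \<comment> \<open>A double root would be a root of the derivative, which is non-zero and of
    smaller degree.\<close>
  have ga: "poly g ?a \<noteq> 0"
  proof
    assume "poly g ?a = 0"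
    moreover have "?C (pderiv f1) = pderiv (?C f1)" by (simp add: of_rat_hom.map_poly_pderiv)
    ultimately have "poly (?C (pderiv f1)) ?a = 0" by (simp add: g pderiv_mult pderiv_pCons del: mult_pCons_left)
    moreover have "pderiv f1 \<noteq> 0" using \<open>degree f1 > 0\<close> by (simp add: pderiv_eq_0_iff)
    ultimately have "degree f1 \<le> degree (pderiv f1)" using min by (simp add: root_def)
    then show False using \<open>degree f1 > 0\<close> by (simp add: degree_pderiv)
  qed
  have roots: "cmod z < \<alpha>" if "poly g z = 0" for z
  proof -
    have "poly (?C f1) z = 0" using that by (simp add: g)
    then have "algebraic_conjugate ?a z"
      using irr f1 unfolding algebraic_conjugate_def is_minimal_poly_def root_def by blast
    moreover have "z \<noteq> ?a" using that ga by auto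
    ultimately show ?thesis using assms by (simp add: perron_number_def)
  qed
  show ?thesis
    by (rule that[OF lead _ ga roots]) (use g f1_rg CP in simp)
qed

section \<open>Linear recurrences with a dominant simple root\<close>

text \<open>The polynomial \<open>p\<close> in the shift operator, applied to the sequence
  \<open>c\<close>. That \<open>act p c\<close> vanishes is the linear recurrence with
  characteristic polynomial \<open>p\<close>.\<close>

definition act :: "complex poly \<Rightarrow> (nat \<Rightarrow> complex) \<Rightarrow> nat \<Rightarrow> complex" where
  "act p c k = (\<Sum>i\<le>degree p. coeff p i * c (k + i))"

lemma act_upto: "degree p \<le> n \<Longrightarrow> act p c k = (\<Sum>i\<le>n. coeff p i * c (k + i))"
  unfolding act_def by (rule sum.mono_neutral_left) (auto simp: coeff_eq_0)

lemma act_add: "act (p + q) c k = act p c k + act q c k"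
proof -
  let ?n = "max (degree p) (degree q)"
  have "degree (p + q) \<le> ?n" by (rule degree_add_le_max)
  then show ?thesis by (simp add: act_upto[of _ ?n] sum.distrib distrib_right)
qed

lemma act_smult: "act (smult a p) c k = a * act p c k"
  by (simp add: act_upto[of _ "degree p"] sum_distrib_left mult.assoc)

lemma act_pCons_0: "act (pCons 0 p) c k = act p c (Suc k)"
proof -
  have "act (pCons 0 p) c k = (\<Sum>i\<le>Suc (degree p). coeff (pCons 0 p) i * c (k + i))"
    by (rule act_upto) (simp add: degree_pCons_le)
  also have "\<dots> = act p c (Suc k)" by (simp add: sum.atMost_Suc_shift act_def del: sum.atMost_Suc)
  finally show ?thesis .
qed

lemma act_linear_mult: "act ([:- z, 1:] * g) c k = act g c (Suc k) - z * act g c k"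
proof -
  have "[:- z, 1:] * g = smult (- z) g + pCons 0 g" by simp
  then show ?thesis by (simp only: act_add act_smult act_pCons_0) simp
qed

text \<open>After index \<open>M\<close> the errors add up to at most the geometric series with sum
  \<open>h\<close>, while the contribution of \<open>u M\<close> decays.\<close>

lemma contraction_tendsto_0:
  fixes u e :: "nat \<Rightarrow> complex"
  assumes rec: "\<And>k. u (Suc k) = \<rho> * u k + e k" and \<rho>: "cmod \<rho> < 1" and e: "e \<longlonglongrightarrow> 0"
  shows "u \<longlonglongrightarrow> 0"
proof (rule LIMSEQ_I)
  fix \<epsilon> :: real assume "\<epsilon> > 0"
  define h where "h = \<epsilon> / 2"
  have h: "h > 0" "\<epsilon> = h + h" using \<open>\<epsilon> > 0\<close> by (simp_all add: h_def)
  let ?r = "cmod \<rho>"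
  have "0 < h * (1 - ?r)" using h \<rho> by simp
  then obtain M where M: "\<And>k. k \<ge> M \<Longrightarrow> cmod (e k) < h * (1 - ?r)"
    using LIMSEQ_D[OF e] by (metis diff_zero)
  have bound: "cmod (u (M + j)) \<le> ?r ^ j * cmod (u M) + h" for j
  proof (induction j)
    case (Suc j)
    have "cmod (u (M + Suc j)) \<le> ?r * cmod (u (M + j)) + cmod (e (M + j))"
      using rec[of "M + j"] norm_triangle_ineq[of "\<rho> * u (M + j)" "e (M + j)"] by (simp add: norm_mult)
    also have "?r * cmod (u (M + j)) \<le> ?r * (?r ^ j * cmod (u M) + h)"
      using Suc by (intro mult_left_mono) auto
    also have "cmod (e (M + j)) \<le> h * (1 - ?r)" by (rule less_imp_le[OF M[OF le_add1]])
    finally show ?case by (simp add: algebra_simps)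
  qed (use h in simp)
  have "(\<lambda>j. ?r ^ j * cmod (u M)) \<longlonglongrightarrow> 0 * cmod (u M)"
    using \<rho> by (intro tendsto_mult LIMSEQ_realpow_zero tendsto_const) auto
  then have "\<forall>\<^sub>F j in sequentially. ?r ^ j * cmod (u M) < h" using h(1) by (intro order_tendstoD) auto
  then obtain J where J: "\<And>j. j \<ge> J \<Longrightarrow> ?r ^ j * cmod (u M) < h" by (auto simp: eventually_sequentially)
  have "cmod (u k - 0) < \<epsilon>" if "k \<ge> M + J" for k
  proof -
    obtain j where j: "k = M + j" "j \<ge> J" using \<open>k \<ge> M + J\<close> by (metis add.assoc le_Suc_ex le_add1)
    then show ?thesis using bound[of j] J[OF j(2)] h(2) by (simp only: diff_zero)
  qed
  then show "\<exists>no. \<forall>n\<ge>no. cmod (u n - 0) < \<epsilon>" by blast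
qed

text \<open>The roots of \<open>g\<close> are removed one at a time. Undoing the factor of a root
  \<open>z\<close> means solving a first order recurrence, and after division by \<alpha>^k its
  ratio is z / \<alpha>, of modulus below 1; multiple roots need no separate treatment.\<close>

lemma act_small_imp_small:
  fixes g :: "complex poly"
  assumes "g \<noteq> 0" "\<alpha> > 0" "\<And>z. poly g z = 0 \<Longrightarrow> cmod z < \<alpha>"
    and "(\<lambda>k. act g c k / of_real \<alpha> ^ k) \<longlonglongrightarrow> 0"
  shows "(\<lambda>k. c k / of_real \<alpha> ^ k) \<longlonglongrightarrow> 0"
  using assms
proof (induction "degree g" arbitrary: g)
  case 0
  then obtain a where a: "g = [:a:]" "a \<noteq> 0" by (metis degree_eq_zeroE pCons_0_0)
  have "(\<lambda>k. inverse a * (act g c k / of_real \<alpha> ^ k)) \<longlonglongrightarrow> inverse a * 0"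
    by (intro tendsto_intros 0)
  then show ?case using a(2) by (simp add: act_def a(1) flip: mult.assoc)
next
  case (Suc n)
  then have "\<not> constant (poly g)" by (simp add: constant_degree)
  then obtain z where z: "poly g z = 0" using fundamental_theorem_of_algebra by blast
  then obtain g' where g': "g = [:- z, 1:] * g'" by (auto simp: poly_eq_0_iff_dvd elim: dvdE)
  have ne: "g' \<noteq> 0" using Suc.prems(1) g' by auto
  have deg: "n = degree g'" using Suc.hyps(2) ne unfolding g' by (subst (asm) degree_mult_eq) auto
  have "(\<lambda>k. act g' c k / of_real \<alpha> ^ k) \<longlonglongrightarrow> 0"
  proof (rule contraction_tendsto_0)
    fix k
    have "act g' c (Suc k) = z * act g' c k + act g c k" unfolding g' act_linear_mult by simp
    then show "act g' c (Suc k) / of_real \<alpha> ^ Suc k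
        = (z / of_real \<alpha>) * (act g' c k / of_real \<alpha> ^ k) + (act g c k / of_real \<alpha> ^ k) / of_real \<alpha>"
      by (simp add: add_divide_distrib mult.commute)
  next
    show "cmod (z / of_real \<alpha>) < 1" using Suc.prems(2) Suc.prems(3)[OF z] by (simp add: norm_divide)
    have "(\<lambda>k. act g c k / of_real \<alpha> ^ k / of_real \<alpha>) \<longlonglongrightarrow> 0 / complex_of_real \<alpha>"
      using Suc.prems by (intro tendsto_intros) auto
    then show "(\<lambda>k. act g c k / of_real \<alpha> ^ k / of_real \<alpha>) \<longlonglongrightarrow> 0" by simp
  qed
  then show ?case using Suc.prems deg ne by (intro Suc.hyps(1)[of g']) (auto simp: g')
qed

lemma act_zero_imp_asymptotic:
  fixes g :: "complex poly"
  assumes \<alpha>: "\<alpha> > 0" and ga: "poly g (of_real \<alpha>) \<noteq> 0"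
    and roots: "\<And>z. poly g z = 0 \<Longrightarrow> cmod z < \<alpha>"
    and zero: "\<And>k. act ([:- of_real \<alpha>, 1:] * g) c k = 0"
  shows "\<exists>r. (\<lambda>k. c k / of_real \<alpha> ^ k) \<longlonglongrightarrow> r"
proof -
  let ?a = "complex_of_real \<alpha>"
  \<comment> \<open>Applying \<open>g\<close> in the shift to \<open>r * \<alpha>^k\<close>
    multiplies it by \<open>poly g \<alpha>\<close>; this \<open>r\<close> matches the geometric
    sequence \<open>act g c\<close>, so that the difference is annihilated by
    \<open>g\<close>.\<close>
  define r where "r = act g c 0 / poly g ?a"
  have geo: "act g c k = ?a ^ k * act g c 0" for k
  proof (induction k)
    case (Suc k)
    then show ?case using zero[of k] unfolding act_linear_mult by simp
  qed simp
  have sub: "act g (\<lambda>k. c k - r * ?a ^ k) k = act g c k - ?a ^ k * (r * poly g ?a)" for k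
    by (simp add: act_def poly_altdef algebra_simps power_add sum_subtractf sum_distrib_left)
  have "r * poly g ?a = act g c 0" using ga by (simp add: r_def)
  then have 0: "act g (\<lambda>k. c k - r * ?a ^ k) k = 0" for k unfolding sub geo[of k] by simp
  have "(\<lambda>k. (c k - r * ?a ^ k) / ?a ^ k) \<longlonglongrightarrow> 0"
  proof (rule act_small_imp_small[OF _ \<alpha> roots])
    show "g \<noteq> 0" using ga by force
    show "(\<lambda>k. act g (\<lambda>k. c k - r * ?a ^ k) k / ?a ^ k) \<longlonglongrightarrow> 0" unfolding 0 by simp
  qed
  then have "(\<lambda>k. (c k - r * ?a ^ k) / ?a ^ k + r) \<longlonglongrightarrow> 0 + r" by (intro tendsto_intros)
  moreover have "(c k - r * ?a ^ k) / ?a ^ k + r = c k / ?a ^ k" for k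
    using \<alpha> by (simp add: diff_divide_distrib)
  ultimately show ?thesis by auto
qed

section \<open>Powers modulo a monic integer polynomial\<close>

text \<open>The remainder of X^k on division by a monic \<open>f\<close> of positive degree:
  multiply by X and cancel the coefficient that reaches the degree of \<open>f\<close>.\<close>

primrec power_mod :: "int poly \<Rightarrow> nat \<Rightarrow> int poly" where
  "power_mod f 0 = 1"
| "power_mod f (Suc k) = pCons 0 (power_mod f k) - smult (coeff (power_mod f k) (degree f - 1)) f"

lemma degree_power_mod:
  assumes "lead_coeff f = 1" "degree f > 0"
  shows "degree (power_mod f k) < degree f"
proof (induction k)
  case (Suc k)
  have "coeff (power_mod f (Suc k)) i = 0" if "i \<ge> degree f" for i
  proof (cases "i = degree f")
    case True
    then show ?thesis using assms by (cases "degree f") (auto simp: coeff_pCons)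
  next
    case False
    then have "i > degree f" using that by simp
    then show ?thesis using Suc by (cases i) (auto simp: coeff_eq_0 coeff_pCons)
  qed
  then have "degree (power_mod f (Suc k)) \<ge> degree f \<Longrightarrow> power_mod f (Suc k) = 0"
    by (metis leading_coeff_0_iff)
  then show ?case using assms(2) by (metis degree_0 linorder_not_less)
qed (use assms in simp)

lemma power_mod_cong: "f dvd power_mod f k - monom 1 k"
proof (induction k)
  case (Suc k)
  have "power_mod f (Suc k) - monom 1 (Suc k)
      = pCons 0 (power_mod f k - monom 1 k) - smult (coeff (power_mod f k) (degree f - 1)) f"
    by (simp add: monom_Suc)
  moreover have "f dvd pCons 0 (power_mod f k - monom 1 k)"
    using dvd_mult[OF Suc, of "[:0, 1:]"] by simp
  ultimately show ?case by (simp only: dvd_diff dvd_smult dvd_refl)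
qed simp

text \<open>The combination of the remainders with the coefficients of \<open>f\<close> is congruent
  to X^k times \<open>f\<close>, hence divisible by \<open>f\<close>, but its degree is smaller than
  that of \<open>f\<close>. So it is zero, coefficient by coefficient.\<close>

lemma power_mod_recurrence:
  assumes f: "lead_coeff f = 1" "degree f > 0"
  shows "(\<Sum>t\<le>degree f. coeff f t * coeff (power_mod f (k + t)) i) = 0"
proof -
  define R where "R = (\<Sum>t\<le>degree f. smult (coeff f t) (power_mod f (k + t)))"
  have "f dvd (\<Sum>t\<le>degree f. smult (coeff f t) (power_mod f (k + t) - monom 1 (k + t)))"
    using power_mod_cong by (intro dvd_sum dvd_smult)
  also have "(\<Sum>t\<le>degree f. smult (coeff f t) (power_mod f (k + t) - monom 1 (k + t)))
      = R - monom 1 k * f"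
  proof -
    have "monom 1 k * f = monom 1 k * (\<Sum>t\<le>degree f. monom (coeff f t) t)"
      by (simp add: poly_as_sum_of_monoms)
    then show ?thesis
      by (simp add: R_def smult_diff_right sum_subtractf sum_distrib_left mult_monom smult_monom)
  qed
  finally have "f dvd R - monom 1 k * f + monom 1 k * f" by (rule dvd_add) simp
  then have "f dvd R" by simp
  moreover have "degree R < degree f"
    unfolding R_def using degree_power_mod[OF f] f(2)
    by (intro degree_sum_less) (auto intro: le_less_trans[OF degree_smult_le])
  ultimately have "R = 0" using dvd_imp_degree_le[of f R] by force
  then have "coeff R i = 0" by simp
  then show ?thesis by (simp add: R_def coeff_sum)
qed

text \<open>The coordinates of \<alpha>^k obey the recurrence of \<open>f\<close>, whose simple root
  \<alpha> exceeds all other roots in modulus. This is the place where the Perron condition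
  acts.\<close>

lemma perron_power_coeffs:
  assumes "perron_number \<alpha>" "\<alpha> > 1"
  obtains n :: nat and c :: "nat \<Rightarrow> nat \<Rightarrow> int" and r :: "nat \<Rightarrow> real" where
    "n > 0" "\<And>k. \<alpha> ^ k = (\<Sum>i<n. of_int (c k i) * \<alpha> ^ i)"
    "\<And>i. (\<lambda>k. of_int (c k i) / \<alpha> ^ k) \<longlonglongrightarrow> r i"
proof -
  obtain f g where f: "lead_coeff f = 1" and fg: "of_int_poly f = [:- of_real \<alpha>, 1:] * g"
    and ga: "poly g (of_real \<alpha>) \<noteq> 0" and roots: "\<And>z. poly g z = 0 \<Longrightarrow> cmod z < \<alpha>"
    using perron_integer_poly[OF assms] by blast
  have "g \<noteq> 0" using ga by auto
  have "degree f = degree (of_int_poly f :: complex poly)" by simp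
  also have "\<dots> = Suc (degree g)" unfolding fg using \<open>g \<noteq> 0\<close> by (subst degree_mult_eq) auto
  finally have d: "degree f > 0" by simp
  define c where "c k i = coeff (power_mod f k) i" for k i
  have root: "poly (of_int_poly f) \<alpha> = 0"
  proof -
    have "complex_of_real (poly (of_int_poly f) \<alpha>) = poly (of_int_poly f) (complex_of_real \<alpha>)"
      by (simp add: poly_altdef)
    also have "\<dots> = 0" by (simp add: fg)
    finally show ?thesis by simp
  qed
  have pow: "\<alpha> ^ k = (\<Sum>i<degree f. of_int (c k i) * \<alpha> ^ i)" for k
  proof -
    obtain h where "power_mod f k - monom 1 k = f * h" using power_mod_cong by (meson dvdE)
    then have "(of_int_poly (power_mod f k) :: real poly) - of_int_poly (monom 1 k) = of_int_poly f * of_int_poly h"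
      by (metis of_int_poly_hom.hom_minus of_int_poly_hom.hom_mult)
    then have "poly (of_int_poly (power_mod f k)) \<alpha> - poly (of_int_poly (monom 1 k)) \<alpha> = 0"
      using root by (metis mult_zero_left poly_diff poly_mult)
    moreover have "poly (of_int_poly (monom 1 k)) \<alpha> = \<alpha> ^ k" by (simp add: map_poly_monom poly_monom)
    moreover have "poly (of_int_poly (power_mod f k)) \<alpha> = (\<Sum>i<degree f. of_int (c k i) * \<alpha> ^ i)"
      unfolding poly_altdef c_def using degree_power_mod[OF f d, of k]
      by (intro sum.mono_neutral_cong_left) (auto simp: coeff_eq_0)
    ultimately show ?thesis by simp
  qed
  have "\<exists>r. (\<lambda>k. of_int (c k i) / \<alpha> ^ k) \<longlonglongrightarrow> r" for i
  proof -
    have "act ([:- of_real \<alpha>, 1:] * g) (\<lambda>k. of_int (c k i)) k = 0" for k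
    proof -
      have "act ([:- of_real \<alpha>, 1:] * g) (\<lambda>k. of_int (c k i)) k
          = of_int (\<Sum>t\<le>degree f. coeff f t * coeff (power_mod f (k + t)) i)"
        unfolding fg[symmetric] by (simp add: act_def c_def)
      then show ?thesis using power_mod_recurrence[OF f d] by simp
    qed
    then obtain r where "(\<lambda>k. of_int (c k i) / complex_of_real \<alpha> ^ k) \<longlonglongrightarrow> r"
      using act_zero_imp_asymptotic[of \<alpha> g "\<lambda>k. of_int (c k i)"] assms(2) ga roots by auto
    then have "(\<lambda>k. Re (of_int (c k i) / complex_of_real \<alpha> ^ k)) \<longlonglongrightarrow> Re r" by (rule tendsto_Re)
    moreover have "of_int (c k i) / complex_of_real \<alpha> ^ k = complex_of_real (of_int (c k i) / \<alpha> ^ k)" for k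
      by simp
    ultimately have "(\<lambda>k. of_int (c k i) / \<alpha> ^ k) \<longlonglongrightarrow> Re r" by (simp only: Re_complex_of_real)
    then show ?thesis by blast
  qed
  then obtain r where "\<And>i. (\<lambda>k. of_int (c k i) / \<alpha> ^ k) \<longlonglongrightarrow> r i" by metis
  with d pow show ?thesis using that by blast
qed

lemma sum_list_telescope: "(\<Sum>t\<leftarrow>[0..<m]. f (Suc t) - f t) = f m - (f 0 :: int)"
  by (induction m) auto

text \<open>The total deviation \<open>D\<close> is spread evenly over the \<open>m\<close>
  summands: the summand with index t receives the increment of floor(D t / m). The increments
  telescope to \<open>D\<close>, and each is between -2 and 2 because |D| is at most 2 m.\<close>

lemma box_sums:
  fixes w z :: "nat \<Rightarrow> int"
  assumes m: "m > 0" and d: "\<And>i. i < n \<Longrightarrow> \<bar>z i - int m * w i\<bar> \<le> 2 * int m"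
  shows "\<exists>V. length V = m \<and> set V \<subseteq> (\<Pi>\<^sub>E i\<in>{..<n}. {w i - 2..w i + 2}) \<and> (\<forall>i<n. (\<Sum>v\<leftarrow>V. v i) = z i)"
proof -
  define D where "D i = z i - int m * w i" for i
  define v where "v t = restrict (\<lambda>i. w i + (D i * int (Suc t) div int m - D i * int t div int m)) {..<n}" for t
  have "v t \<in> (\<Pi>\<^sub>E i\<in>{..<n}. {w i - 2..w i + 2})" for t
  proof (rule PiE_I)
    fix i assume "i \<in> {..<n}"
    then have i: "i < n" by simp
    have D: "- (2 * int m) \<le> D i" "D i \<le> 2 * int m" using d[OF i] by (auto simp: D_def)
    have "D i * int (Suc t) = D i * int t + D i" by (simp add: algebra_simps)
    then have le: "D i * int (Suc t) \<le> D i * int t + 2 * int m" "D i * int t + (- 2) * int m \<le> D i * int (Suc t)"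
      using D by linarith+
    have mp: "0 < int m" using m by simp
    note zdiv_mono1[OF le(1) mp] zdiv_mono1[OF le(2) mp]
    moreover have "(D i * int t + 2 * int m) div int m = D i * int t div int m + 2"
      "(D i * int t + (- 2) * int m) div int m = D i * int t div int m + (- 2)"
      using m by (simp_all only: div_mult_self1 of_nat_eq_0_iff neq0_conv)
    ultimately show "v t i \<in> {w i - 2..w i + 2}" using i unfolding v_def by simp
  qed (simp add: v_def)
  moreover have "(\<Sum>x\<leftarrow>map v [0..<m]. x i) = z i" if "i < n" for i
  proof -
    have "(\<Sum>x\<leftarrow>map v [0..<m]. x i)
        = (\<Sum>t\<leftarrow>[0..<m]. w i + (D i * int (Suc t) div int m - D i * int t div int m))"
      using that by (simp add: v_def o_def)
    also have "\<dots> = (\<Sum>t\<leftarrow>[0..<m]. w i) + (\<Sum>t\<leftarrow>[0..<m]. D i * int (Suc t) div int m - D i * int t div int m)"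
      by (rule sum_list_addf)
    also have "\<dots> = int m * w i + D i"
      unfolding sum_list_telescope[of "\<lambda>t. D i * int t div int m"] using m by (simp add: sum_list_triv)
    finally show ?thesis by (simp add: D_def)
  qed
  ultimately show ?thesis by (intro exI[of _ "map v [0..<m]"]) auto
qed

lemma sum_list_linear:
  fixes \<alpha> :: real and xs :: "(nat \<Rightarrow> int) list"
  shows "(\<Sum>v\<leftarrow>xs. \<Sum>i<n. of_int (v i) * \<alpha> ^ i) = (\<Sum>i<n. of_int (\<Sum>v\<leftarrow>xs. v i) * \<alpha> ^ i)"
  by (induction xs) (simp_all add: sum.distrib distrib_right)

lemma sum_list_concat_replicate:
  fixes g :: "'a \<Rightarrow> int"
  shows "(\<Sum>v\<leftarrow>concat (map (replicate q) xs). g v) = int q * (\<Sum>v\<leftarrow>xs. g v)"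
  by (induction xs) (simp_all add: sum_list_replicate distrib_left)

text \<open>Identify the integer vector \<open>s\<close> with the number \<open>\<Sum> s\<^sub>i \<alpha>\<^sup>i\<close>. The lattice points of a box
  around a far point of the dominant eigendirection generate, as a semigroup, every lattice point
  that is far out and close to that direction; multiplication by a high power of \<open>\<alpha>\<close> moves every
  point of the box into this region.\<close>
lemma perron_semigroup:
  assumes "perron_number \<alpha>" "\<alpha> > 1" and q: "q > 0"
  obtains S :: "(nat \<Rightarrow> int) set" and val :: "(nat \<Rightarrow> int) \<Rightarrow> real"
      and xs :: "(nat \<Rightarrow> int) list" and V :: "(nat \<Rightarrow> int) \<Rightarrow> (nat \<Rightarrow> int) list" and M :: nat where
    "finite S" "S \<noteq> {}" "\<And>s. s \<in> S \<Longrightarrow> 0 < val s" "set xs = S"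
    "\<And>s. s \<in> S \<Longrightarrow> set (V s) \<subseteq> S" "\<And>s. s \<in> S \<Longrightarrow> q dvd length (V s)"
    "\<And>s. s \<in> S \<Longrightarrow> sum_list (map val (V s @ concat (map (replicate q) xs))) = (\<alpha> ^ Suc M - \<alpha> ^ M) * val s"
proof -
  obtain n c r where n: "n > 0" and pow: "\<And>k. \<alpha> ^ k = (\<Sum>i<n. of_int (c k i) * \<alpha> ^ i)"
    and r: "\<And>i. (\<lambda>k. of_int (c k i) / \<alpha> ^ k) \<longlonglongrightarrow> r i"
    using perron_power_coeffs[OF assms(1,2)] by blast
  have \<alpha>: "\<alpha> > 0" using assms(2) by simp
  define val where "val s = (\<Sum>i<n. of_int (s i) * \<alpha> ^ i)" for s :: "nat \<Rightarrow> int"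
  \<comment> \<open>The dominant direction \<open>r\<close> represents the number 1, so that
    \<open>T * r\<close> represents \<open>T\<close>.\<close>
  have norm: "(\<Sum>i<n. r i * \<alpha> ^ i) = 1"
  proof (rule LIMSEQ_unique)
    show "(\<lambda>k. \<Sum>i<n. of_int (c k i) / \<alpha> ^ k * \<alpha> ^ i) \<longlonglongrightarrow> (\<Sum>i<n. r i * \<alpha> ^ i)"
      by (intro tendsto_intros r)
    have "(\<Sum>i<n. of_int (c k i) / \<alpha> ^ k * \<alpha> ^ i) = 1" for k
    proof -
      have "(\<Sum>i<n. of_int (c k i) / \<alpha> ^ k * \<alpha> ^ i) = (\<Sum>i<n. of_int (c k i) * \<alpha> ^ i) / \<alpha> ^ k"
        by (simp add: sum_divide_distrib)
      also have "\<dots> = 1" unfolding pow[symmetric] using \<alpha> by simp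
      finally show ?thesis .
    qed
    then show "(\<lambda>k. \<Sum>i<n. of_int (c k i) / \<alpha> ^ k * \<alpha> ^ i) \<longlonglongrightarrow> 1" by simp
  qed
  \<comment> \<open>Rounding in \<open>w\<close> loses at most 1 and the box has radius 2, so
    coordinates are at least \<open>T * r i - 3\<close>; this \<open>T\<close> then leaves a value
    of at least 1.\<close>
  define T where "T = 3 * (\<Sum>i<n. \<alpha> ^ i) + 1"
  have T: "T > 0" using \<alpha> by (auto simp: T_def intro!: add_nonneg_pos sum_nonneg)
  define w where "w i = \<lfloor>T * r i\<rfloor>" for i
  define S where "S = (\<Pi>\<^sub>E i\<in>{..<n}. {w i - 2..w i + 2})"
  have fin: "finite S" unfolding S_def by (intro finite_PiE) auto
  have "restrict w {..<n} \<in> S" by (auto simp: S_def)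
  then have ne: "S \<noteq> {}" by blast
  have val_pos: "0 < val s" if "s \<in> S" for s
  proof -
    have "T * r i - 3 \<le> of_int (s i)" if "i < n" for i
    proof -
      have "w i - 2 \<le> s i" using PiE_mem[OF \<open>s \<in> S\<close>[unfolded S_def], of i] that by simp
      then show ?thesis unfolding w_def by linarith
    qed
    then have "(\<Sum>i<n. (T * r i - 3) * \<alpha> ^ i) \<le> val s"
      unfolding val_def using \<alpha> by (intro sum_mono mult_right_mono) auto
    moreover have "(\<Sum>i<n. (T * r i - 3) * \<alpha> ^ i) = T * (\<Sum>i<n. r i * \<alpha> ^ i) - 3 * (\<Sum>i<n. \<alpha> ^ i)"
      by (simp add: left_diff_distrib sum_subtractf sum_distrib_left mult.assoc)
    ultimately show ?thesis using norm by (simp add: T_def)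
  qed
  obtain xs where xs: "set xs = S" using finite_list[OF fin] by blast
  \<comment> \<open>The coordinates of the part forced into every image, \<open>q\<close> copies of
    each point of the box. Such a run of equal points later meets every residue modulo
    \<open>q\<close>, which makes the labelled substitution primitive.\<close>
  define Q where "Q i = int q * (\<Sum>s\<leftarrow>xs. s i)" for i
  \<comment> \<open>The coordinates of \<alpha>^(M+1) - \<alpha>^M times \<open>s\<close>, obtained
    by expanding each power of \<alpha>. The subtracted term is the copy of itself that a top letter
    keeps.\<close>
  define z where "z s M i = (\<Sum>j<n. s j * (c (Suc M + j) i - c (M + j) i))" for s :: "nat \<Rightarrow> int" and M i
  have z_val: "(\<Sum>i<n. of_int (z s M i) * \<alpha> ^ i) = (\<alpha> ^ Suc M - \<alpha> ^ M) * val s" for s M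
  proof -
    have "(\<Sum>i<n. of_int (z s M i) * \<alpha> ^ i)
        = (\<Sum>i<n. \<Sum>j<n. of_int (s j) * (of_int (c (Suc M + j) i) * \<alpha> ^ i - of_int (c (M + j) i) * \<alpha> ^ i))"
      unfolding z_def of_int_sum sum_distrib_right
      by (intro sum.cong refl) (simp add: algebra_simps)
    also have "\<dots> = (\<Sum>j<n. \<Sum>i<n. of_int (s j) * (of_int (c (Suc M + j) i) * \<alpha> ^ i - of_int (c (M + j) i) * \<alpha> ^ i))"
      by (rule sum.swap)
    also have "\<dots> = (\<Sum>j<n. of_int (s j) * (\<alpha> ^ (Suc M + j) - \<alpha> ^ (M + j)))"
      unfolding pow[of "Suc M + j" for j] pow[of "M + j" for j]
      by (simp add: sum_distrib_left sum_subtractf right_diff_distrib)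
    also have "\<dots> = (\<alpha> ^ Suc M - \<alpha> ^ M) * val s"
      unfolding val_def sum_distrib_left by (intro sum.cong) (auto simp: power_add algebra_simps)
    finally show ?thesis .
  qed
  \<comment> \<open>The number of summands: the target is about (\<alpha> - 1) (val s) \<alpha>^M
    times the direction \<open>r\<close>, the box is centred near \<open>T\<close> times it.
    Rounding down to a multiple of \<open>q\<close> preserves image lengths modulo \<open>q\<close>
    and is negligible for large \<open>M\<close>.\<close>
  define m where "m s M = q * nat \<lfloor>(\<alpha> - 1) * val s * \<alpha> ^ M / (q * T)\<rfloor>" for s M
  have ev: "\<forall>\<^sub>F M in sequentially. m s M > 0 \<and> (\<forall>i\<in>{..<n}. \<bar>z s M i - Q i - int (m s M) * w i\<bar> \<le> 2 * int (m s M))"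
    if s: "s \<in> S" for s
  proof -
    define \<kappa> where "\<kappa> = (\<alpha> - 1) * val s"
    have \<kappa>: "\<kappa> > 0" using val_pos[OF s] assms(2) by (simp add: \<kappa>_def)
    have inv0: "(\<lambda>M. 1 / \<alpha> ^ M) \<longlonglongrightarrow> 0"
      using LIMSEQ_inverse_realpow_zero[OF assms(2)] by (simp add: inverse_eq_divide)
    have m_lim: "(\<lambda>M. real (m s M) / \<alpha> ^ M) \<longlonglongrightarrow> \<kappa> / T"
    proof (rule tendsto_sandwich)
      have b: "\<kappa> * \<alpha> ^ M / T - q \<le> real (m s M)" "real (m s M) \<le> \<kappa> * \<alpha> ^ M / T" for M
      proof -
        let ?y = "\<kappa> * \<alpha> ^ M / (q * T)"
        have "0 \<le> ?y" using \<kappa> \<alpha> T by simp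
        then have "?y - 1 \<le> real (nat \<lfloor>?y\<rfloor>)" "real (nat \<lfloor>?y\<rfloor>) \<le> ?y" by linarith+
        then have "q * (?y - 1) \<le> q * real (nat \<lfloor>?y\<rfloor>)" "q * real (nat \<lfloor>?y\<rfloor>) \<le> q * ?y"
          by (intro mult_left_mono; simp)+
        moreover have "q * ?y = \<kappa> * \<alpha> ^ M / T" using q by simp
        ultimately show "\<kappa> * \<alpha> ^ M / T - q \<le> real (m s M)" "real (m s M) \<le> \<kappa> * \<alpha> ^ M / T"
          by (simp_all add: m_def \<kappa>_def right_diff_distrib)
      qed
      show "\<forall>\<^sub>F M in sequentially. \<kappa> / T - q * (1 / \<alpha> ^ M) \<le> real (m s M) / \<alpha> ^ M"
      proof (intro always_eventually allI)
        fix M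
        have "(\<kappa> * \<alpha> ^ M / T - q) / \<alpha> ^ M \<le> real (m s M) / \<alpha> ^ M"
          using b(1) \<alpha> by (intro divide_right_mono) auto
        then show "\<kappa> / T - q * (1 / \<alpha> ^ M) \<le> real (m s M) / \<alpha> ^ M"
          using \<alpha> by (simp add: diff_divide_distrib)
      qed
      show "\<forall>\<^sub>F M in sequentially. real (m s M) / \<alpha> ^ M \<le> \<kappa> / T"
      proof (intro always_eventually allI)
        fix M
        have "real (m s M) / \<alpha> ^ M \<le> \<kappa> * \<alpha> ^ M / T / \<alpha> ^ M"
          using b(2) \<alpha> by (intro divide_right_mono) auto
        then show "real (m s M) / \<alpha> ^ M \<le> \<kappa> / T" using \<alpha> by simp
      qed
      have "(\<lambda>M. \<kappa> / T - q * (1 / \<alpha> ^ M)) \<longlonglongrightarrow> \<kappa> / T - real q * 0" by (intro tendsto_intros inv0)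
      then show "(\<lambda>M. \<kappa> / T - q * (1 / \<alpha> ^ M)) \<longlonglongrightarrow> \<kappa> / T" by simp
    qed (rule tendsto_const)
    have m_pos: "\<forall>\<^sub>F M in sequentially. m s M > 0"
    proof -
      have "\<forall>\<^sub>F M in sequentially. 0 < real (m s M) / \<alpha> ^ M"
        using \<kappa> T by (intro order_tendstoD(1)[OF m_lim]) simp
      then show ?thesis by (rule eventually_mono) (use \<alpha> in \<open>auto simp: zero_less_divide_iff\<close>)
    qed
    have z_lim: "(\<lambda>M. of_int (z s M i) / \<alpha> ^ M) \<longlonglongrightarrow> \<kappa> * r i" for i
    proof -
      have "(\<lambda>M. of_int (c (k + M) i) / \<alpha> ^ M) \<longlonglongrightarrow> \<alpha> ^ k * r i" for k
      proof -
        have "(\<lambda>M. \<alpha> ^ k * (of_int (c (M + k) i) / \<alpha> ^ (M + k))) \<longlonglongrightarrow> \<alpha> ^ k * r i"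
          by (intro tendsto_intros LIMSEQ_ignore_initial_segment r)
        moreover have "\<alpha> ^ k * (of_int (c (M + k) i) / \<alpha> ^ (M + k)) = of_int (c (k + M) i) / \<alpha> ^ M" for M
          using \<alpha> by (simp add: power_add add.commute)
        ultimately show ?thesis by simp
      qed
      then have "(\<lambda>M. \<Sum>j<n. of_int (s j) * (of_int (c (Suc j + M) i) / \<alpha> ^ M - of_int (c (j + M) i) / \<alpha> ^ M))
          \<longlonglongrightarrow> (\<Sum>j<n. of_int (s j) * (\<alpha> ^ Suc j * r i - \<alpha> ^ j * r i))"
        by (intro tendsto_intros)
      moreover have "(\<Sum>j<n. of_int (s j) * (of_int (c (Suc j + M) i) / \<alpha> ^ M - of_int (c (j + M) i) / \<alpha> ^ M))
          = of_int (z s M i) / \<alpha> ^ M" for M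
        by (simp add: z_def sum_divide_distrib diff_divide_distrib right_diff_distrib add.commute)
      moreover have "(\<Sum>j<n. of_int (s j) * (\<alpha> ^ Suc j * r i - \<alpha> ^ j * r i)) = \<kappa> * r i"
        unfolding \<kappa>_def val_def sum_distrib_left sum_distrib_right
        by (intro sum.cong) (auto simp: algebra_simps)
      ultimately show ?thesis by simp
    qed
    have box: "\<forall>\<^sub>F M in sequentially. \<bar>z s M i - Q i - int (m s M) * w i\<bar> \<le> 2 * int (m s M)" for i
    proof -
      \<comment> \<open>The mean that the \<open>m\<close> summands must have in coordinate
        \<open>i\<close>, measured from the centre of the box. Its limit is the fractional part of
        \<open>T * r i\<close>, safely inside the radius 2; the fixed vector \<open>Q\<close>
        disappears in the limit.\<close>
      let ?q = "\<lambda>M. (of_int (z s M i) / \<alpha> ^ M - of_int (Q i) * (1 / \<alpha> ^ M)) / (real (m s M) / \<alpha> ^ M) - of_int (w i)"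
      have "?q \<longlonglongrightarrow> (\<kappa> * r i - of_int (Q i) * 0) / (\<kappa> / T) - of_int (w i)"
        using \<kappa> T by (intro tendsto_intros z_lim inv0 m_lim) auto
      then have lim: "?q \<longlonglongrightarrow> T * r i - of_int (w i)" using \<kappa> T by (simp add: mult.commute)
      have "T * r i - of_int (w i) < 2" "-2 < T * r i - of_int (w i)" unfolding w_def by linarith+
      then have "\<forall>\<^sub>F M in sequentially. ?q M < 2" "\<forall>\<^sub>F M in sequentially. - 2 < ?q M"
        using order_tendstoD[OF lim] by blast+
      then show ?thesis using m_pos
      proof eventually_elim
        case (elim M)
        have mp: "real (m s M) > 0" using elim(3) by simp
        have "?q M = (of_int (z s M i) - of_int (Q i) - real (m s M) * of_int (w i)) / real (m s M)"
          using mp \<alpha> by (simp add: field_simps)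
        then have "\<bar>of_int (z s M i) - of_int (Q i) - real (m s M) * of_int (w i)\<bar> \<le> 2 * real (m s M)"
          using elim(1,2) mp by (simp add: pos_divide_less_eq pos_less_divide_eq)
        then have "\<bar>real_of_int (z s M i - Q i - int (m s M) * w i)\<bar> \<le> real_of_int (2 * int (m s M))" by simp
        then show ?case by linarith
      qed
    qed
    then have "\<forall>\<^sub>F M in sequentially. \<forall>i\<in>{..<n}. \<bar>z s M i - Q i - int (m s M) * w i\<bar> \<le> 2 * int (m s M)"
      by (intro eventually_ball_finite) auto
    with m_pos show ?thesis by (rule eventually_conj)
  qed
  have "\<forall>\<^sub>F M in sequentially. \<forall>s\<in>S. m s M > 0 \<and> (\<forall>i\<in>{..<n}. \<bar>z s M i - Q i - int (m s M) * w i\<bar> \<le> 2 * int (m s M))"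
    using ev by (intro eventually_ball_finite fin) blast
  then obtain M where M: "\<And>s. s \<in> S \<Longrightarrow> m s M > 0"
    "\<And>s i. s \<in> S \<Longrightarrow> i < n \<Longrightarrow> \<bar>z s M i - Q i - int (m s M) * w i\<bar> \<le> 2 * int (m s M)"
    by (auto simp: eventually_sequentially)
  have "\<exists>V. length V = m s M \<and> set V \<subseteq> S \<and> (\<forall>i<n. (\<Sum>v\<leftarrow>V. v i) = z s M i - Q i)" if "s \<in> S" for s
    unfolding S_def by (rule box_sums) (use M that in auto)
  then obtain V where V: "\<And>s. s \<in> S \<Longrightarrow> length (V s) = m s M" "\<And>s. s \<in> S \<Longrightarrow> set (V s) \<subseteq> S"
    "\<And>s i. s \<in> S \<Longrightarrow> i < n \<Longrightarrow> (\<Sum>v\<leftarrow>V s. v i) = z s M i - Q i" by metis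
  have sum_V: "sum_list (map val (V s @ concat (map (replicate q) xs))) = (\<alpha> ^ Suc M - \<alpha> ^ M) * val s"
    if s: "s \<in> S" for s
  proof -
    let ?W = "V s @ concat (map (replicate q) xs)"
    have *: "(\<Sum>v\<leftarrow>?W. v i) = z s M i" if "i < n" for i
    proof -
      have "(\<Sum>v\<leftarrow>?W. v i) = (\<Sum>v\<leftarrow>V s. v i) + (\<Sum>v\<leftarrow>concat (map (replicate q) xs). v i)" by simp
      then show ?thesis using V(3)[OF s that] by (simp only: sum_list_concat_replicate Q_def)
    qed
    have "sum_list (map val ?W) = (\<Sum>i<n. of_int (\<Sum>v\<leftarrow>?W. v i) * \<alpha> ^ i)"
      unfolding val_def[abs_def] by (rule sum_list_linear)
    also have "\<dots> = (\<Sum>i<n. of_int (z s M i) * \<alpha> ^ i)"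
      by (intro sum.cong refl) (simp only: * lessThan_iff)
    finally show ?thesis unfolding z_val .
  qed
  show ?thesis
    by (rule that[OF fin ne val_pos xs V(2) _ sum_V]) (auto simp: V(1) m_def)
qed

section \<open>Periodic sequences are substitutive\<close>

lemma iter_map:
  fixes s :: "'b \<Rightarrow> 'b list" and \<sigma> :: "'c \<Rightarrow> 'c list"
  assumes closed: "\<And>b. b \<in> B \<Longrightarrow> set (s b) \<subseteq> B"
    and \<sigma>: "\<And>b. b \<in> B \<Longrightarrow> \<sigma> (h b) = map h (s b)"
    and w: "set w \<subseteq> B"
  shows "(morph_word \<sigma> ^^ n) (map h w) = map h ((morph_word s ^^ n) w)" "set ((morph_word s ^^ n) w) \<subseteq> B"
proof -
  have step: "morph_word \<sigma> (map h w) = map h (morph_word s w)" "set (morph_word s w) \<subseteq> B" if "set w \<subseteq> B" for w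
    using that closed by (induction w) (auto simp: \<sigma>)
  have "(morph_word \<sigma> ^^ n) (map h w) = map h ((morph_word s ^^ n) w) \<and> set ((morph_word s ^^ n) w) \<subseteq> B"
    by (induction n) (use w step in auto)
  then show "(morph_word \<sigma> ^^ n) (map h w) = map h ((morph_word s ^^ n) w)" "set ((morph_word s ^^ n) w) \<subseteq> B"
    by auto
qed

lemma sum_list_count:
  fixes f :: "'b \<Rightarrow> real"
  assumes "finite A" "set xs \<subseteq> A"
  shows "(\<Sum>x\<leftarrow>xs. f x) = (\<Sum>x\<in>A. real (count_list xs x) * f x)"
  using assms(2)
proof (induction xs)
  case (Cons z xs)
  have "(\<Sum>x\<in>A. real (count_list (z # xs) x) * f x)
      = (\<Sum>x\<in>A. (if x = z then f x else 0) + real (count_list xs x) * f x)"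
    by (intro sum.cong) (auto simp: distrib_right)
  also have "\<dots> = f z + (\<Sum>x\<in>A. real (count_list xs x) * f x)"
    using Cons.prems assms(1) by (simp add: sum.distrib)
  finally show ?case using Cons by simp
qed simp

text \<open>A substitution on an arbitrary finite set of letters, numbered only at the end. The
  weights \<open>u\<close> are a left eigenvector of the matrix, and the letter \<open>a\<close>
  both starts the fixed point and carries a loop that excludes cyclic behaviour.\<close>

locale substitution_graph =
  fixes B :: "'b set" and s :: "'b \<Rightarrow> 'b list" and u :: "'b \<Rightarrow> real" and \<theta> :: real
    and a :: 'b and w :: "'b list"
  assumes fin: "finite B" and a: "a \<in> B" and closed: "\<And>b. b \<in> B \<Longrightarrow> set (s b) \<subseteq> B"
    and ne: "\<And>b. b \<in> B \<Longrightarrow> s b \<noteq> []" and start: "s a = a # w" and w: "w \<noteq> []"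
    and conn: "\<And>b c. b \<in> B \<Longrightarrow> c \<in> B \<Longrightarrow> \<exists>n. c \<in> set ((morph_word s ^^ n) [b])"
    and u: "\<And>b. b \<in> B \<Longrightarrow> 0 < u b" and eig: "\<And>b. b \<in> B \<Longrightarrow> (\<Sum>c\<leftarrow>s b. u c) = \<theta> * u b"
begin

abbreviation T :: "nat \<Rightarrow> 'b list \<Rightarrow> 'b list" where "T n \<equiv> morph_word s ^^ n"

lemma set_T: "set v \<subseteq> B \<Longrightarrow> set (T n v) \<subseteq> B"
  using iter_map(2)[of B s s id v n] closed by simp

lemma T_ne: "set v \<subseteq> B \<Longrightarrow> v \<noteq> [] \<Longrightarrow> T n v \<noteq> []"
proof (induction n)
  case (Suc n)
  then have "T n v \<noteq> []" "set (T n v) \<subseteq> B" using set_T by auto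
  then show ?case using ne by (cases "T n v") auto
qed simp

lemma T_Suc_a: "T (Suc n) [a] = T n [a] @ T n w"
  unfolding iter_Suc_letter start by (rule iter_Cons)

lemma set_w: "set w \<subseteq> B"
  using closed[OF a] start by simp

lemma length_T_a: "n < length (T n [a])"
proof (induction n)
  case (Suc n)
  moreover have "T n w \<noteq> []" using T_ne[OF set_w w] .
  then have "0 < length (T n w)" by simp
  ultimately show ?case unfolding T_Suc_a length_append by linarith
qed simp

lemma T_a_prefix: "m \<le> n \<Longrightarrow> \<exists>v. T n [a] = T m [a] @ v"
proof (induction n rule: dec_induct)
  case (step n)
  then show ?case unfolding T_Suc_a by auto
qed simp

text \<open>The limit of the nested words \<open>T n [a]\<close>; the word of order \<open>i\<close>
  is longer than \<open>i\<close>, so its letter at index \<open>i\<close> is final.\<close>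

definition Y :: "nat \<Rightarrow> 'b" where "Y i = T i [a] ! i"

lemma Y_eq: "i < length (T n [a]) \<Longrightarrow> Y i = T n [a] ! i"
proof -
  assume i: "i < length (T n [a])"
  show ?thesis
  proof (cases "n \<le> i")
    case True
    then obtain v where "T i [a] = T n [a] @ v" using T_a_prefix by blast
    then show ?thesis using i by (simp add: Y_def nth_append)
  next
    case False
    then obtain v where "T n [a] = T i [a] @ v" using T_a_prefix[of i n] by auto
    then show ?thesis using length_T_a[of i] by (simp add: Y_def nth_append)
  qed
qed

lemma Y_in: "Y i \<in> B"
  using length_T_a[of i] set_T[of "[a]" i] a unfolding Y_def by (auto intro: nth_mem)

text \<open>Every letter reaches \<open>a\<close>, and \<open>a\<close> reaches every letter. As the
  words \<open>T n [a]\<close> are nested, any path through \<open>a\<close> can be prolonged by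
  waiting at \<open>a\<close>, so one common exponent works for all pairs.\<close>

lemma uniform: "\<exists>k>0. \<forall>b\<in>B. \<forall>c\<in>B. c \<in> set (T k [b])"
proof -
  obtain f where f: "\<And>b. b \<in> B \<Longrightarrow> a \<in> set (T (f b) [b])" using conn[OF _ a] by metis
  obtain g where g: "\<And>c. c \<in> B \<Longrightarrow> c \<in> set (T (g c) [a])" using conn[OF a] by metis
  define k1 where "k1 = Max (f ` B)"
  define k2 where "k2 = Suc (Max (g ` B))"
  have mono: "c \<in> set (T n [a])" if "c \<in> set (T m [a])" "m \<le> n" for c m n
    using T_a_prefix[OF that(2)] that(1) by auto
  have trans: "c \<in> set (T (m + n) [b])" if "c \<in> set (T m [x])" "x \<in> set (T n [b])" for b c x m n
  proof -
    have "set (T (m + n) [b]) = set (T m (T n [b]))" by (simp add: funpow_add)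
    then show ?thesis unfolding set_iter[of m s "T n [b]"] using that by blast
  qed
  have "c \<in> set (T (k2 + k1) [b])" if b: "b \<in> B" and c: "c \<in> B" for b c
  proof -
    have "f b \<le> k1" unfolding k1_def using fin b by (intro Max_ge) auto
    moreover have "a \<in> set (T (k1 - f b) [a])" by (rule mono[of _ 0]) auto
    ultimately have "a \<in> set (T k1 [b])" using trans[OF _ f[OF b], of a "k1 - f b"] by simp
    moreover have "g c \<le> k2" unfolding k2_def using fin c by (intro le_SucI Max_ge) auto
    then have "c \<in> set (T k2 [a])" using mono[OF g[OF c]] by blast
    ultimately show ?thesis using trans by blast
  qed
  then show ?thesis by (intro exI[of _ "k2 + k1"]) (simp add: k2_def)
qed

lemma length_T_ge:
  assumes "b \<in> B" and k: "a \<in> set (T k [b])"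
  shows "n \<le> length (T (n + k) [b])"
proof -
  have "length (T n [a]) \<le> (\<Sum>c\<leftarrow>T k [b]. length (T n [c]))"
    using k by (intro member_le_sum_list) auto
  also have "\<dots> = length (T (n + k) [b])" by (simp add: funpow_add flip: length_iter)
  finally show ?thesis using length_T_a[of n] by linarith
qed

theorem substitutive: "substitutive_primitive \<theta> (smap (\<lambda>i. \<phi> (Y i)) nats)"
proof -
  define d where "d = card B"
  obtain h where h: "bij_betw h B {..<d}"
    using ex_bij_betw_finite_nat[OF fin] unfolding d_def atLeast0LessThan by blast
  define g where "g = inv_into B h"
  have gh: "g (h b) = b" if "b \<in> B" for b
    unfolding g_def using that h by (simp add: bij_betw_def)
  have hg: "h (g i) = i" "g i \<in> B" if "i < d" for i
    using that h unfolding g_def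
    by (simp_all add: bij_betw_def f_inv_into_f[of i h B] inv_into_into[of i h B])
  have h_less: "h b < d" if "b \<in> B" for b using h that by (auto simp: bij_betw_def)
  have h_inj: "inj_on h B" using h by (simp add: bij_betw_def)
  define \<sigma> where "\<sigma> i = map h (s (g i))" for i
  have \<sigma>_h: "\<sigma> (h b) = map h (s b)" if "b \<in> B" for b using gh[OF that] by (simp add: \<sigma>_def)
  have set_\<sigma>: "set (\<sigma> i) \<subseteq> {..<d}" if "i < d" for i
    using closed[OF hg(2)[OF that]] h_less by (auto simp: \<sigma>_def)
  have iter: "(morph_word \<sigma> ^^ n) [i] = map h (T n [g i])" if "i < d" for n i
    using iter_map(1)[of B s \<sigma> h "[g i]" n] closed \<sigma>_h hg[OF that] by simp
  obtain k where k: "k > 0" "\<And>b c. b \<in> B \<Longrightarrow> c \<in> B \<Longrightarrow> c \<in> set (T k [b])" using uniform by blast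
  have prim: "primitive_subst d \<sigma>"
    unfolding primitive_subst_def substitution_def
  proof (intro conjI allI impI)
    fix i assume i: "i < d"
    show "set (\<sigma> i) \<subseteq> {..<d}" by (rule set_\<sigma>[OF i])
    have "Z \<le> length ((morph_word \<sigma> ^^ n) [i])" if "n \<ge> Z + k" for Z n
      using length_T_ge[OF hg(2)[OF i], of k "n - k"] k(2)[OF hg(2)[OF i] a] that
      by (simp add: iter[OF i])
    then show "filterlim (\<lambda>n. length ((morph_word \<sigma> ^^ n) [i])) at_top sequentially"
      unfolding filterlim_at_top eventually_sequentially by blast
  next
    have "(subst_mat d \<sigma> ^\<^sub>m k) $$ (i, j) > 0" if "i < d" "j < d" for i j
    proof -
      have "g i \<in> set (T k [g j])" using k(2) hg that by blast
      then have "i \<in> set ((morph_word \<sigma> ^^ k) [j])" using hg[OF that(1)] by (force simp: iter[OF that(2)])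
      then have "count_list ((morph_word \<sigma> ^^ k) [j]) i \<noteq> 0" by (simp add: count_list_0_iff)
      then show ?thesis using subst_mat_pow[OF set_\<sigma> that] by simp
    qed
    then show "\<exists>k>0. \<forall>i<d. \<forall>j<d. (subst_mat d \<sigma> ^\<^sub>m k) $$ (i, j) > 0" using k(1) by blast
  qed
  have dom: "dominant_eigenvalue d \<sigma> = \<theta>"
    unfolding dominant_eigenvalue_def
  proof (rule spectral_radius_left[where f = "\<lambda>i. u (g i)"])
    show "subst_mat d \<sigma> \<in> carrier_mat d d" by (simp add: subst_mat_def)
    show "0 < d" using h_less[OF a] by simp
    show "0 < u (g i)" if "i < d" for i using u hg(2)[OF that] .
    fix j assume j: "j < d"
    have "(\<Sum>i<d. u (g i) * real (subst_mat d \<sigma> $$ (i, j))) = (\<Sum>i<d. real (count_list (\<sigma> j) i) * u (g i))"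
      using j by (intro sum.cong) (auto simp: subst_mat_def)
    also have "\<dots> = (\<Sum>i\<leftarrow>\<sigma> j. u (g i))"
      by (rule sum_list_count[symmetric, OF _ set_\<sigma>[OF j]]) simp
    also have "\<dots> = (\<Sum>c\<leftarrow>s (g j). u c)"
      using closed[OF hg(2)[OF j]] gh by (auto simp: \<sigma>_def o_def subset_iff intro!: arg_cong[of _ _ sum_list])
    also have "\<dots> = \<theta> * u (g j)" by (rule eig[OF hg(2)[OF j]])
    finally show "(\<Sum>i<d. u (g i) * real (subst_mat d \<sigma> $$ (i, j))) = \<theta> * u (g j)" .
  qed
  define y where "y = smap (\<lambda>i. h (Y i)) nats"
  have y_nth: "y !! i = h (Y i)" for i by (simp add: y_def)
  have y_in: "y \<in> streams {..<d}" using h_less Y_in by (auto simp: streams_iff_sset sset_range y_nth)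
  have y_stake: "stake (length (T n [a])) y = map h (T n [a])" for n
    by (rule nth_equalityI) (auto simp: y_nth Y_eq)
  have fixed: "morph_seq \<sigma> y = y"
  proof -
    have "morph_seq \<sigma> y !! n = y !! n" for n
    proof -
      let ?M = "length (T n [a])"
      have "\<sigma> i \<noteq> []" if "i \<in> sset y" for i
        using that y_in ne hg(2) by (auto simp: \<sigma>_def streams_iff_sset)
      then have "morph_seq \<sigma> y = morph_word \<sigma> (stake ?M y) @- morph_seq \<sigma> (sdrop ?M y)"
        by (rule morph_seq_unfold)
      also have "morph_word \<sigma> (stake ?M y) = map h (T (Suc n) [a])"
        using iter_map(1)[of B s \<sigma> h "T n [a]" 1] closed \<sigma>_h set_T[of "[a]" n] a by (simp add: y_stake)
      finally have "morph_seq \<sigma> y !! n = map h (T (Suc n) [a]) ! n"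
        using length_T_a[of "Suc n"] by (simp only: shift_snth_less length_map)
      then show ?thesis
        using length_T_a[of "Suc n"] Y_eq[of n "Suc n"] by (simp only: y_nth nth_map)
    qed
    then show ?thesis using smap_alt[of "\<lambda>x. x" "morph_seq \<sigma> y" y] by (simp add: stream.map_ident)
  qed
  have "smap (\<lambda>i. \<phi> (Y i)) nats = smap (\<lambda>i. \<phi> (g i)) y"
    by (simp add: y_def stream.map_comp o_def gh Y_in)
  then show ?thesis unfolding substitutive_primitive_def using prim dom y_in fixed by blast
qed

end

definition labelled_from :: "nat \<Rightarrow> nat \<Rightarrow> ('b \<Rightarrow> nat) \<Rightarrow> 'b list \<Rightarrow> bool" where
  "labelled_from q j lab xs \<longleftrightarrow> (\<forall>t<length xs. lab (xs ! t) = (j + t) mod q)"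

lemma labelled_from_mod: "labelled_from q (j mod q) lab xs = labelled_from q j lab xs"
  by (simp add: labelled_from_def mod_add_left_eq)

lemma labelled_from_append:
  assumes "labelled_from q j lab xs" "labelled_from q (j + length xs) lab ys"
  shows "labelled_from q j lab (xs @ ys)"
  unfolding labelled_from_def
proof (intro allI impI)
  fix t assume t: "t < length (xs @ ys)"
  show "lab ((xs @ ys) ! t) = (j + t) mod q"
  proof (cases "t < length xs")
    case True
    then show ?thesis using assms(1) by (simp add: labelled_from_def nth_append)
  next
    case False
    then obtain t' where "t = length xs + t'" by (metis le_Suc_ex not_less)
    then show ?thesis using assms(2) t by (simp add: labelled_from_def nth_append add.assoc)
  qed
qed

text \<open>An image of length 1 modulo \<open>q\<close> advances the label by one, exactly as the
  letter itself does, so the next image starts with the right label.\<close>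

lemma labelled_from_morph:
  assumes s: "\<And>b. labelled_from q (lab b) lab (s b)" "\<And>b. length (s b) mod q = 1 mod q"
  shows "labelled_from q j lab xs \<Longrightarrow> labelled_from q j lab (morph_word s xs)"
proof (induction xs arbitrary: j)
  case Nil
  then show ?case by (simp add: labelled_from_def)
next
  case (Cons x xs)
  have x: "lab x = j mod q" using Cons.prems by (auto simp: labelled_from_def)
  have "labelled_from q (Suc j) lab xs"
    unfolding labelled_from_def
  proof (intro allI impI)
    fix t assume "t < length xs"
    then show "lab (xs ! t) = (Suc j + t) mod q"
      using Cons.prems[unfolded labelled_from_def, rule_format, of "Suc t"] by simp
  qed
  then have "labelled_from q (Suc j) lab (morph_word s xs)" by (rule Cons.IH)
  moreover have "(j + length (s x)) mod q = Suc j mod q"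
    using mod_add_right_eq[of j "length (s x)" q] mod_add_right_eq[of j 1 q] s(2)[of x] by simp
  ultimately have "labelled_from q (j + length (s x)) lab (morph_word s xs)"
    using labelled_from_mod[of q "j + length (s x)" lab "morph_word s xs"]
      labelled_from_mod[of q "Suc j" lab "morph_word s xs"] by simp
  moreover have "labelled_from q j lab (s x)" using s(1)[of x] x by (simp add: labelled_from_mod)
  ultimately show ?case by (simp add: labelled_from_append)
qed

lemma residue_shift:
  assumes "j < q" shows "\<exists>e<q. (c + e) mod q = (j :: nat)"
proof (intro exI conjI)
  let ?e = "(j + (q - c mod q)) mod q"
  show "?e < q" using assms by simp
  have "c mod q < q" using assms by simp
  have "(c + ?e) mod q = (c mod q + (j + (q - c mod q))) mod q" by (simp add: mod_simps)
  also have "c mod q + (j + (q - c mod q)) = j + q" using \<open>c mod q < q\<close> by simp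
  finally show "(c + ?e) mod q = j" using assms by simp
qed

theorem periodic_imp_substitutive:
  fixes v :: "'a list"
  assumes perron: "perron_number \<alpha>" "\<alpha> > 1" and v: "v \<noteq> []"
  shows "substitutive_primitive \<alpha> (cycle v)"
proof -
  define q where "q = length v"
  have q: "q > 0" using v by (simp add: q_def)
  obtain S :: "(nat \<Rightarrow> int) set" and val xs V M where S: "finite S" "S \<noteq> {}"
    and val: "\<And>s. s \<in> S \<Longrightarrow> 0 < val s" and xs: "set xs = S"
    and V: "\<And>s. s \<in> S \<Longrightarrow> set (V s) \<subseteq> S" "\<And>s. s \<in> S \<Longrightarrow> q dvd length (V s)"
    and sum_W: "\<And>s. s \<in> S \<Longrightarrow>
      sum_list (map val (V s @ concat (map (replicate q) xs))) = (\<alpha> ^ Suc M - \<alpha> ^ M) * val s"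
    by (rule perron_semigroup[OF perron q]) (rule that; assumption)
  \<comment> \<open>The empty word outside \<open>S\<close> keeps the divisibility of the length
    valid for all arguments, so that the labelling properties hold for every triple and not only on
    \<open>B\<close>.\<close>
  define W where "W s = (if s \<in> S then V s else []) @ concat (map (replicate q) xs)" for s
  have len_rep: "length (concat (map (replicate q) xs)) = length xs * q" for xs :: "(nat \<Rightarrow> int) list"
    by (induction xs) auto
  have W_len: "q dvd length (W s)" for s using V(2) by (auto simp: W_def len_rep)
  have W_set: "set (W s) = S" for s using V(1) xs q by (auto simp: W_def)
  have W_block: "\<exists>t0. \<forall>e<q. t0 + e < length (W s) \<and> W s ! (t0 + e) = s'" if mem: "s' \<in> S" for s s'
  proof -
    obtain ys zs where "xs = ys @ s' # zs" using split_list[of s' xs] mem xs by blast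
    then have "W s = ((if s \<in> S then V s else []) @ concat (map (replicate q) ys))
        @ replicate q s' @ concat (map (replicate q) zs)" by (simp add: W_def)
    then obtain l r where W: "W s = l @ replicate q s' @ r" by blast
    have "length l + e < length (W s) \<and> W s ! (length l + e) = s'" if "e < q" for e
      using that unfolding W nth_append_length_plus by (simp add: nth_append)
    then show ?thesis by blast
  qed
  \<comment> \<open>The letter \<open>(i, s, j)\<close> has weight \<open>\<alpha>\<^sup>i val s\<close> and stands at a position congruent to \<open>j\<close> modulo \<open>q\<close>.\<close>
  define lab :: "nat \<times> (nat \<Rightarrow> int) \<times> nat \<Rightarrow> nat" where "lab = (\<lambda>(i, s, j). j)"
  \<comment> \<open>Below level \<open>M\<close> a letter just climbs, which multiplies its weight
    by \<alpha>. At the top it reproduces itself and spends the remaining weight on the points of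
    \<open>W s\<close> at level 0. The reductions modulo \<open>q\<close> matter for triples outside
    \<open>B\<close>, where they make the labels correct as well.\<close>
  define \<zeta> :: "nat \<times> (nat \<Rightarrow> int) \<times> nat \<Rightarrow> (nat \<times> (nat \<Rightarrow> int) \<times> nat) list" where
    "\<zeta> = (\<lambda>(i, s, j). if i < M then [(Suc i, s, j mod q)]
      else (M, s, j mod q) # map (\<lambda>t. (0, W s ! t, (j + 1 + t) mod q)) [0..<length (W s)])"
  define u where "u = (\<lambda>(i, s, j::nat). \<alpha> ^ i * val s)"
  define B where "B = {..M} \<times> S \<times> {..<q}"
  have \<alpha>: "\<alpha> > 0" using perron(2) by simp
  obtain s0 where s0: "s0 \<in> S" using S(2) by blast
  let ?a = "(M, s0, 0)"
  let ?w = "map (\<lambda>t. (0::nat, W s0 ! t, (0 + 1 + t) mod q)) [0..<length (W s0)]"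
  define reach where "reach b c \<longleftrightarrow> (\<exists>n. c \<in> set ((morph_word \<zeta> ^^ n) [b]))" for b c
  have reach_step: "reach b d" if step: "c \<in> set (\<zeta> b)" "reach c d" for b c d
  proof -
    obtain n where "d \<in> set ((morph_word \<zeta> ^^ n) [c])" using step(2) by (auto simp: reach_def)
    then have "d \<in> set ((morph_word \<zeta> ^^ n) (\<zeta> b))" unfolding set_iter[of n \<zeta> "\<zeta> b"] using step(1) by blast
    then show ?thesis unfolding reach_def iter_Suc_letter[symmetric] by blast
  qed
  have reach_refl: "reach b b" for b unfolding reach_def by (rule exI[of _ 0]) simp
  have climb: "reach (i, s, j) b" if "j < q" "reach (i + k, s, j) b" "i + k \<le> M" for i s j k b
    using that(2,3)
  proof (induction k arbitrary: i)
    case (Suc k)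
    have step: "(Suc i, s, j) \<in> set (\<zeta> (i, s, j))" using Suc.prems that(1) by (simp add: \<zeta>_def)
    have "reach (Suc i, s, j) b" by (rule Suc.IH) (use Suc.prems in simp_all)
    then show ?case by (rule reach_step[OF step])
  qed simp
  \<comment> \<open>Within a run of \<open>q\<close> equal points the labels take all residues, so
    one top letter produces every letter of level 0.\<close>
  have jump: "(0, s', j') \<in> set (\<zeta> (M, s, j))" if target: "s' \<in> S" "j' < q" for s s' j j'
  proof -
    obtain t0 where t0: "\<And>e. e < q \<Longrightarrow> t0 + e < length (W s)" "\<And>e. e < q \<Longrightarrow> W s ! (t0 + e) = s'"
      using W_block[OF target(1)] by blast
    obtain e where e: "e < q" "(j + 1 + t0 + e) mod q = j'" using residue_shift[OF target(2)] by blast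
    have "(0 :: nat, s', j') = (0, W s ! (t0 + e), (j + 1 + (t0 + e)) mod q)"
      using t0(2)[OF e(1)] e(2) by (simp only: add.assoc)
    moreover have "t0 + e \<in> set [0..<length (W s)]" using t0(1)[OF e(1)] by simp
    ultimately have "(0 :: nat, s', j') \<in> set (map (\<lambda>t. (0, W s ! t, (j + 1 + t) mod q)) [0..<length (W s)])"
      unfolding set_map by (rule image_eqI)
    then show ?thesis by (simp add: \<zeta>_def)
  qed
  have conn: "reach b c" if mem: "b \<in> B" "c \<in> B" for b c
  proof -
    obtain i s j i' s' j' where b: "b = (i, s, j)" "i \<le> M" "j < q" and c: "c = (i', s', j')" "i' \<le> M" "s' \<in> S" "j' < q"
      using mem by (auto simp: B_def)
    have "reach (0, s', j') c" by (rule climb[OF c(4), of 0 i']) (use c reach_refl in simp_all)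
    then have "reach (M, s, j) c" by (rule reach_step[OF jump[OF c(3,4)]])
    then have "reach (i + (M - i), s, j) c" using b(2) by simp
    then show ?thesis unfolding b(1) by (rule climb[OF b(3)]) (use b(2) in simp)
  qed
  interpret substitution_graph B \<zeta> u \<alpha> ?a ?w
  proof
    show "finite B" using S(1) by (simp add: B_def)
    show "?a \<in> B" using s0 q by (simp add: B_def)
    show "set (\<zeta> b) \<subseteq> B" if "b \<in> B" for b
    proof -
      have "W s ! t \<in> S" if "t < length (W s)" for s t using nth_mem[OF that] W_set by simp
      then show ?thesis using that q by (auto simp: \<zeta>_def B_def split: if_splits)
    qed
    show "\<zeta> b \<noteq> []" if "b \<in> B" for b by (auto simp: \<zeta>_def split: prod.split)
    show "\<zeta> ?a = ?a # ?w" using q by (simp add: \<zeta>_def)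
    have "W s0 \<noteq> []" using W_set[of s0] S(2) by auto
    then show "?w \<noteq> []" by simp
    show "\<exists>n. c \<in> set ((morph_word \<zeta> ^^ n) [b])" if "b \<in> B" "c \<in> B" for b c
      using conn[OF that] by (simp add: reach_def)
    show "0 < u b" if "b \<in> B" for b using that val \<alpha> by (auto simp: u_def B_def)
    show "(\<Sum>c\<leftarrow>\<zeta> b. u c) = \<alpha> * u b" if b: "b \<in> B" for b
    proof -
      obtain i s j where bb: "b = (i, s, j)" "i \<le> M" "s \<in> S" using b by (auto simp: B_def)
      show ?thesis
      proof (cases "i < M")
        case True
        then show ?thesis by (simp add: bb \<zeta>_def u_def)
      next
        case False
        then have i: "i = M" using bb by simp
        have "(\<Sum>t\<leftarrow>[0..<length (W s)]. val (W s ! t)) = sum_list (map val (W s))"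
          using arg_cong[OF map_nth[of "W s"], of "\<lambda>l. sum_list (map val l)"] by (simp add: o_def)
        also have "\<dots> = (\<alpha> ^ Suc M - \<alpha> ^ M) * val s" using sum_W[OF bb(3)] bb(3) by (simp only: W_def if_True)
        finally show ?thesis by (simp add: bb(1) i \<zeta>_def u_def o_def algebra_simps)
      qed
    qed
  qed
  have lab_\<zeta>: "labelled_from q (lab b) lab (\<zeta> b)" "length (\<zeta> b) mod q = 1 mod q" for b
  proof -
    obtain i s j where b: "b = (i, s, j)" by (cases b)
    show "labelled_from q (lab b) lab (\<zeta> b)"
      unfolding labelled_from_def
    proof (intro allI impI)
      fix t assume t: "t < length (\<zeta> b)"
      show "lab (\<zeta> b ! t) = (lab b + t) mod q"
      proof (cases t)
        case 0
        then show ?thesis by (simp add: b \<zeta>_def lab_def)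
      next
        case (Suc t')
        then have "\<not> i < M" using t by (auto simp: b \<zeta>_def)
        then show ?thesis using t Suc by (simp add: b \<zeta>_def lab_def)
      qed
    qed
    show "length (\<zeta> b) mod q = 1 mod q"
    proof (cases "i < M")
      case False
      obtain k where "length (W s) = q * k" using W_len[of s] by (rule dvdE)
      then have "length (\<zeta> b) = 1 + q * k" using False by (simp add: b \<zeta>_def)
      then show ?thesis by (simp only: mod_mult_self2)
    qed (simp add: b \<zeta>_def)
  qed
  have lab_T: "labelled_from q 0 lab (T n [?a])" for n
  proof (induction n)
    case 0
    then show ?case by (simp add: labelled_from_def lab_def)
  next
    case (Suc n)
    then show ?case using labelled_from_morph[OF lab_\<zeta>] by simp
  qed
  have lab_Y: "lab (Y i) = i mod q" for i
    using lab_T[of i] length_T_a[of i] by (simp add: labelled_from_def Y_def)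
  let ?x = "smap (\<lambda>i. v ! lab (Y i)) nats"
  have nth: "?x !! i = v ! (i mod q)" for i by (simp add: lab_Y)
  have "has_period (snth ?x) q" unfolding has_period_def nth by simp
  then have cyc: "?x = cycle (stake q ?x)" using q by (rule has_period_imp_cycle)
  have "stake q ?x = v"
  proof (rule nth_equalityI)
    fix i assume "i < length (stake q ?x)"
    then have "i < q" by simp
    then have "stake q ?x ! i = v ! (i mod q)" by (simp only: stake_nth nth)
    then show "stake q ?x ! i = v ! i" using \<open>i < q\<close> by simp
  qed (simp add: q_def)
  then have "cycle (stake q ?x) = cycle v" by (rule arg_cong)
  with cyc have "?x = cycle v" by (rule trans)
  then show ?thesis using substitutive[of "\<lambda>b. v ! lab b"] by (simp only:)
qed

text \<open>The predicate \<open>perron_number\<close> also holds for 0, 1 and negative integers,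
  whereas the dominant eigenvalue of a growing primitive substitution exceeds 1; this is why
  \<open>\<alpha> > 1\<close> and \<open>\<beta> > 1\<close> are stated.\<close>

theorem theorem8:
  fixes \<alpha> \<beta> :: real and A :: "'a set" and x :: "'a stream"
  assumes "perron_number \<alpha>" and "perron_number \<beta>"
    and "\<alpha> > 1" and "\<beta> > 1"
    and "mult_independent \<alpha> \<beta>"
    and "finite A" and "x \<in> streams A"
  shows "substitutive_primitive \<alpha> x \<and> substitutive_primitive \<beta> x \<longleftrightarrow> periodic x"
proof
  assume "substitutive_primitive \<alpha> x \<and> substitutive_primitive \<beta> x"
  then show "periodic x" using cobham_primitive assms(3-5) by blast
next
  assume "periodic x"
  then obtain v where "v \<noteq> []" "x = cycle v" unfolding periodic_def by blast
  then show "substitutive_primitive \<alpha> x \<and> substitutive_primitive \<beta> x"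
    using periodic_imp_substitutive assms(1-4) by blast
qed

end
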